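(* For any ordinals $\alpha, \beta < \omega_1$ with $\beta \geq 1$, any $\boldsymbol{\Sigma}^0_{\alpha+1}$-measurable function $f \colon 2^{\mathbb{N}} \rightarrow \{0,1\}$, and any $(\alpha+\beta)$-tree function $g \colon 2^{\mathbb{N}} \rightarrow \{0,1\}$, there exists a restriction $\rho$ such that $f^\rho$ is constant and $g^\rho$ is a $\beta$-tree function.
   Context: Borel classes. $2^{\mathbb{N}}$ has the product topology. A set $S\subseteq 2^{\mathbb{N}}$ is $\boldsymbol{\Sigma}^0_0$ (equivalently $\boldsymbol{\Pi}^0_0$) if it is clopen. For $1\le\alpha<\omega_1$, a set is $\boldsymbol{\Sigma}^0_\alpha$ (resp. $\boldsymbol{\Pi}^0_\alpha$) if it is a countable union (resp. intersection) of sets $S_n$, $n\in\mathbb{N}$, each of which is $\boldsymbol{\Pi}^0_{\beta_n}$ (resp. $\boldsymbol{\Sigma}^0_{\beta_n}$) for some $\beta_n<\alpha$ (for $\alpha\geq 1$ this is the usual Borel hierarchy). A function $f\colon 2^{\mathbb{N}}\to\{0,1\}$ is $\boldsymbol{\Sigma}^0_\alpha$-measurable if $f^{-1}(U)\in\boldsymbol{\Sigma}^0_\alpha$ for every $U\subseteq\{0,1\}$. Tree functions. The full trees $T_\alpha$ ($\alpha<\omega_1$) are rooted trees defined recursively: $T_0$ is a single vertex (the root); $T_{\alpha+1}$ consists of a root whose children are the roots of $\omega$-many disjoint copies of $T_\alpha$; for limit $\alpha$, $T_\alpha$ consists of a root whose children are the roots of $\omega$-many disjoint copies of $T_\beta$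 for each $\beta<\alpha$. A full alternating tree of rank $\alpha$ is obtained from $T_\alpha$ by labeling the leaves injectively with variables $x_i$ (positive literals), and labeling each non-leaf vertex with $\wedge$ or $\vee$ so that no $\wedge$-vertex has an $\wedge$-vertex as a child and no $\vee$-vertex has a $\vee$-vertex as a child. On an input $x$, a leaf labeled $x_i$ evaluates to the $i$-th bit of $x$, an $\wedge$-vertex (resp. $\vee$-vertex) evaluates to the conjunction (resp. disjunction) of the values of its children, and the output is the value of the root. A function to $\{0,1\}$ is an $\alpha$-tree function if it is computed by a full alternating tree of rank $\alpha$ (not all variables need appear as labels). The same definition is used for functions on $2^I$ with $I\subseteq\mathbb{N}$, with the variables being $x_i$, $i\in I$. Restrictions. A restriction is a function $\rho\colon\mathbb{N}\to\{0,1,*\}$. For a function $f$ on $2^{\mathbb{N}}$, the restricted function $f^\rho$ has domain $2^{\rho^{-1}(\{*\})}$: given values for the variables $x_i$ with $\rho(i)=*$, it evaluates $f$ on the input obtained by setting every other $x_i$ to $\rho(i)$. *)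

theory Defs
  imports "HOL-Analysis.Analysis"
begin

section \<open>Countable ordinals\<close>

text \<open>
  The ordinals below the first uncountable ordinal, realised as the well-order
  \<^term>\<open>cardSuc natLeq\<close>. The lemmas \<open>countable_lessThan_omega1\<close>
  and \<open>uncountable_omega1\<close> below determine this well-order up to isomorphism.
\<close>

typedef omega1 = "Field (cardSuc natLeq)"
proof -
  have "Field (cardSuc natLeq) \<noteq> {}"
    using cardSuc_finite[OF natLeq_Card_order] by (metis Field_natLeq finite.emptyI infinite_UNIV_nat)
  then show ?thesis by blast
qed

lemma cardSuc_natLeq_Well_order: "Well_order (cardSuc natLeq)"
  by (rule cardSuc_Well_order[OF natLeq_Card_order])

instantiation omega1 :: wellorder
begin

definition less_eq_omega1 :: "omega1 \<Rightarrow> omega1 \<Rightarrow> bool"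
  where "a \<le> b \<longleftrightarrow> (Rep_omega1 a, Rep_omega1 b) \<in> cardSuc natLeq"

definition less_omega1 :: "omega1 \<Rightarrow> omega1 \<Rightarrow> bool"
  where "(a::omega1) < b \<longleftrightarrow> a \<le> b \<and> \<not> b \<le> a"

instance
proof
  note wo = cardSuc_natLeq_Well_order
  have refl: "refl_on (Field (cardSuc natLeq)) (cardSuc natLeq)"
    and trans: "trans (cardSuc natLeq)"
    and antisym: "antisym (cardSuc natLeq)"
    and total: "total_on (Field (cardSuc natLeq)) (cardSuc natLeq)"
    and wf: "wf (cardSuc natLeq - Id)"
    using wo unfolding well_order_on_def linear_order_on_def partial_order_on_def preorder_on_def
    by auto
  fix x y z :: omega1
  show "x < y \<longleftrightarrow> x \<le> y \<and> \<not> y \<le> x" by (rule less_omega1_def)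
  show "x \<le> x"
    using refl Rep_omega1[of x] unfolding less_eq_omega1_def by (auto dest: refl_onD)
  show "x \<le> z" if "x \<le> y" "y \<le> z"
    using trans that unfolding less_eq_omega1_def by (auto dest: transD)
  show "x = y" if "x \<le> y" "y \<le> x"
    using antisym that unfolding less_eq_omega1_def by (auto dest: antisymD simp: Rep_omega1_inject)
  show "x \<le> y \<or> y \<le> x"
    using total refl Rep_omega1[of x] Rep_omega1[of y] unfolding less_eq_omega1_def
    by (metis refl_onD total_on_def)
  show "P a" if step: "\<And>x. (\<And>y. y < x \<Longrightarrow> P y) \<Longrightarrow> P x" for P and a :: omega1
  proof -
    have "wf (inv_image (cardSuc natLeq - Id) Rep_omega1)"
      using wf by (rule wf_inv_image)
    moreover have "inv_image (cardSuc natLeq - Id) Rep_omega1 = {(x, y). x < y}"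
    proof -
      have "(Rep_omega1 x, Rep_omega1 y) \<in> cardSuc natLeq - Id \<longleftrightarrow> x < y" for x y
        using antisym refl Rep_omega1[of x] unfolding less_omega1_def less_eq_omega1_def
        by (auto dest: antisymD refl_onD simp: Rep_omega1_inject)
      then show ?thesis by (auto simp: inv_image_def)
    qed
    ultimately have "wf {(x, y :: omega1). x < y}" by simp
    then show ?thesis by (rule wf_induct_rule) (use step in auto)
  qed
qed

end

unbundle cardinal_syntax

lemma countable_iff_card_of_natLeq: "countable A \<longleftrightarrow> ( |A| \<le>o natLeq )"
proof -
  have "countable A \<longleftrightarrow> ( |A| \<le>o |UNIV :: nat set| )"
    unfolding countable_def using card_of_ordLeq[of A "UNIV :: nat set"] by simp
  also have "\<dots> \<longleftrightarrow> ( |A| \<le>o natLeq )"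
    using card_of_nat ordIso_symmetric ordLeq_ordIso_trans by blast
  finally show ?thesis .
qed

lemma uncountable_omega1: "uncountable (UNIV :: omega1 set)"
proof
  assume "countable (UNIV :: omega1 set)"
  then have "countable (range Rep_omega1)" by (rule countable_image)
  then have "countable (Field (cardSuc natLeq))"
    by (simp add: type_definition.Rep_range[OF type_definition_omega1])
  then have "|Field (cardSuc natLeq)| \<le>o natLeq"
    by (simp add: countable_iff_card_of_natLeq)
  then have "cardSuc natLeq \<le>o natLeq"
    using card_of_Field_ordIso[OF cardSuc_Card_order[OF natLeq_Card_order]]
      ordIso_ordLeq_trans ordIso_symmetric by blast
  then show False
    using cardSuc_greater[OF natLeq_Card_order] not_ordLess_ordLeq by blast
qed

lemma countable_lessThan_omega1: "countable {..< a :: omega1}"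
proof -
  let ?U = "underS (cardSuc natLeq) (Rep_omega1 a)"
  have "|?U| <o cardSuc natLeq"
    by (rule card_of_underS[OF cardSuc_Card_order[OF natLeq_Card_order] Rep_omega1])
  then have "countable ?U"
    by (simp add: countable_iff_card_of_natLeq
        cardSuc_ordLeq_ordLess[OF natLeq_Card_order card_of_Card_order])
  moreover have "Rep_omega1 ` {..<a} \<subseteq> ?U"
    by (auto simp: underS_def Rep_omega1_inject less_eq_omega1_def[symmetric])
  ultimately have "countable (Rep_omega1 ` {..<a})"
    by (rule countable_subset[rotated])
  then show ?thesis
    by (rule countable_image_inj_on) (auto simp: inj_on_def Rep_omega1_inject)
qed

lemma countable_bounded_omega1:
  fixes A :: "omega1 set"
  assumes "countable A"
  obtains u where "\<And>a. a \<in> A \<Longrightarrow> a < u"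
proof -
  have "countable (\<Union>a\<in>A. insert a {..<a})"
    using assms countable_lessThan_omega1 by auto
  then obtain u where "u \<notin> (\<Union>a\<in>A. insert a {..<a})"
    using uncountable_omega1 by (metis UNIV_eq_I)
  then have "a < u" if "a \<in> A" for a
    using that by (auto simp: not_less order_less_le)
  then show thesis by (rule that)
qed

unbundle no cardinal_syntax

instantiation omega1 :: "{zero, one}"
begin

definition zero_omega1 :: omega1 where "(0 :: omega1) = (LEAST a. True)"

definition one_omega1 :: omega1 where "(1 :: omega1) = (LEAST a. 0 < a)"

instance ..

end

text \<open>
  Ordinal addition: \<open>a + b\<close> is the least ordinal that is at least \<open>a\<close> and exceeds
  \<open>a + d\<close> for all \<open>d < b\<close>. The usual recursion equations are derived below.
\<close>

instantiation omega1 :: plus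
begin

function plus_omega1 :: "omega1 \<Rightarrow> omega1 \<Rightarrow> omega1"
  where "plus_omega1 a b = (LEAST c. a \<le> c \<and> (\<forall>e \<in> plus_omega1 a ` {..<b}. e < c))"
  by auto
termination
  by (relation "inv_image {(x, y). x < y} snd") (auto intro: wf)

instance ..

end

declare plus_omega1.simps [simp del]

lemma zero_le_omega1: "0 \<le> (a :: omega1)"
  unfolding zero_omega1_def by (rule Least_le) simp

lemma add_le_omega1_iff: "a + b \<le> c \<longleftrightarrow> a \<le> c \<and> (\<forall>d<b. a + d < c)" for a b c :: omega1
proof -
  let ?P = "\<lambda>c. a \<le> c \<and> (\<forall>e \<in> plus a ` {..<b}. e < c)"
  have "countable (insert a (plus a ` {..<b}))"
    by (simp add: countable_lessThan_omega1)
  then obtain u where "\<And>e. e \<in> insert a (plus a ` {..<b}) \<Longrightarrow> e < u"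
    using countable_bounded_omega1 by blast
  then have "?P u" by force
  then have "?P (a + b)"
    unfolding plus_omega1.simps[of a b] by (rule LeastI)
  moreover have "a + b \<le> c" if "?P c"
    unfolding plus_omega1.simps[of a b] using that by (rule Least_le)
  ultimately have "a + b \<le> c \<longleftrightarrow> ?P c"
    using order.trans[of a "a + b" c] order_less_le_trans[of _ "a + b" c] by blast
  then show ?thesis by auto
qed

lemma add_zero_omega1: "a + 0 = (a :: omega1)"
  using add_le_omega1_iff[of a 0 "a + 0"] add_le_omega1_iff[of a 0 a] zero_le_omega1
  by (auto simp: not_le[symmetric])

lemma less_one_omega1_iff: "d < 1 \<longleftrightarrow> d = (0 :: omega1)"
proof -
  obtain u :: omega1 where "0 < u"
    using countable_bounded_omega1[of "{0}"] by auto
  then have "0 < (1 :: omega1)" unfolding one_omega1_def by (rule LeastI)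
  moreover have "1 \<le> d" if "0 < d"
    unfolding one_omega1_def using that by (rule Least_le)
  ultimately show ?thesis
    by (metis leD order_le_less zero_le_omega1)
qed

lemma succ_le_omega1_iff: "a + 1 \<le> c \<longleftrightarrow> a < c" for a c :: omega1
  by (auto simp: add_le_omega1_iff[of a 1] less_one_omega1_iff add_zero_omega1)

lemma less_succ_omega1_iff: "d < b + 1 \<longleftrightarrow> d \<le> b" for b d :: omega1
  using succ_le_omega1_iff[of b d] by (metis not_le)

lemma add_succ_omega1: "a + (b + 1) = (a + b) + 1" for a b :: omega1
proof -
  have "a + (b + 1) \<le> c \<longleftrightarrow> a + b < c" for c
  proof
    assume "a + (b + 1) \<le> c"
    then show "a + b < c"
      using add_le_omega1_iff[of a "b + 1" c] by (simp add: less_succ_omega1_iff)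
  next
    assume c: "a + b < c"
    have ab: "a \<le> a + b" "\<And>d. d < b \<Longrightarrow> a + d < a + b"
      using add_le_omega1_iff[of a b "a + b"] by auto
    have "a + d < c" if "d \<le> b" for d
      using that c order.strict_trans[OF ab(2)[of d] c] by (cases "d = b") auto
    moreover have "a \<le> c"
      using ab(1) c by (rule order.trans[OF _ order_less_imp_le])
    ultimately show "a + (b + 1) \<le> c"
      by (simp add: add_le_omega1_iff[of a "b + 1" c] less_succ_omega1_iff)
  qed
  then show ?thesis
    by (metis order.antisym order.refl succ_le_omega1_iff)
qed

definition limit_omega1 :: "omega1 \<Rightarrow> bool"
  where "limit_omega1 a \<longleftrightarrow> a \<noteq> 0 \<and> (\<nexists>b. a = b + 1)"

lemma add_limit_omega1:
  fixes a b :: omega1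
  assumes "limit_omega1 b"
  shows "a + b \<le> c \<longleftrightarrow> (\<forall>d<b. a + d \<le> c)"
proof
  assume "a + b \<le> c"
  then show "\<forall>d<b. a + d \<le> c"
    using add_le_omega1_iff[of a b c] by (simp add: order_less_imp_le)
next
  assume c: "\<forall>d<b. a + d \<le> c"
  have "0 < b"
    using assms zero_le_omega1[of b] by (simp add: limit_omega1_def order_less_le)
  then have "a \<le> c"
    using c add_zero_omega1[of a] by metis
  moreover have "a + d < c" if "d < b" for d
  proof -
    have "d + 1 \<le> b" "d + 1 \<noteq> b"
      using that assms by (auto simp: succ_le_omega1_iff limit_omega1_def)
    then have "a + (d + 1) \<le> c"
      using c by (simp add: order_less_le)
    then show ?thesis
      by (simp add: add_succ_omega1 succ_le_omega1_iff)
  qed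
  ultimately show "a + b \<le> c"
    by (simp add: add_le_omega1_iff[of a b c])
qed

section \<open>The Borel hierarchy on Cantor space\<close>

text \<open>
  Cantor space is \<^typ>\<open>nat \<Rightarrow> bool\<close>, whose topology is the product of discrete spaces.
  The side condition \<open>b n < a\<close> confines the union and intersection rules to \<open>a \<ge> 1\<close>.
\<close>

inductive Sigma0 :: "omega1 \<Rightarrow> (nat \<Rightarrow> bool) set \<Rightarrow> bool"
  and Pi0 :: "omega1 \<Rightarrow> (nat \<Rightarrow> bool) set \<Rightarrow> bool"
where
  Sigma0_clopen: "\<lbrakk>open S; closed S\<rbrakk> \<Longrightarrow> Sigma0 0 S"
| Pi0_clopen: "\<lbrakk>open S; closed S\<rbrakk> \<Longrightarrow> Pi0 0 S"
| Sigma0_Union: "(\<And>n::nat. b n < a \<and> Pi0 (b n) (S n)) \<Longrightarrow> Sigma0 a (\<Union>n. S n)"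
| Pi0_Inter: "(\<And>n::nat. b n < a \<and> Sigma0 (b n) (S n)) \<Longrightarrow> Pi0 a (\<Inter>n. S n)"

definition Sigma0_measurable :: "omega1 \<Rightarrow> ((nat \<Rightarrow> bool) \<Rightarrow> bool) \<Rightarrow> bool"
  where "Sigma0_measurable a f \<longleftrightarrow> (\<forall>U. Sigma0 a (f -` U))"

section \<open>Alternating trees\<close>

datatype gate = And | Or

text \<open>
  Trees whose leaves carry variable indices and whose inner vertices carry a gate and have
  children enumerated by the natural numbers. In every full tree each vertex that is not a
  leaf has countably infinitely many children, since every ordinal involved is countable.
\<close>

datatype (vars: 'v) tree = Leaf 'v | Node gate "nat \<Rightarrow> 'v tree"

text \<open>
  \<open>full a t\<close>: forgetting labels, \<open>t\<close> is isomorphic to the full tree of rank \<open>a\<close>. In the limit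
  case \<open>b n\<close> is the rank of the \<open>n\<close>-th child, so that each \<open>d < a\<close> contributes \<open>\<omega>\<close> many
  children.
\<close>

inductive full :: "omega1 \<Rightarrow> 'v tree \<Rightarrow> bool" where
  full_zero: "full 0 (Leaf i)"
| full_succ: "(\<And>n. full a (c n)) \<Longrightarrow> full (a + 1) (Node g c)"
| full_limit: "\<lbrakk>limit_omega1 a; \<And>n. b n < a \<and> full (b n) (c n); \<And>d. d < a \<Longrightarrow> infinite {n. b n = d}\<rbrakk>
    \<Longrightarrow> full a (Node g c)"

text \<open>Distinct leaves carry distinct labels.\<close>

primrec inj_labelled :: "'v tree \<Rightarrow> bool" where
  "inj_labelled (Leaf i) \<longleftrightarrow> True"
| "inj_labelled (Node g c) \<longleftrightarrow> (\<forall>n. inj_labelled (c n)) \<and> disjoint_family (\<lambda>n. vars (c n))"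

primrec alternating :: "'v tree \<Rightarrow> bool" where
  "alternating (Leaf i) \<longleftrightarrow> True"
| "alternating (Node g c) \<longleftrightarrow> (\<forall>n. alternating (c n) \<and> (\<nexists>c'. c n = Node g c'))"

primrec eval_tree :: "('v \<Rightarrow> bool) \<Rightarrow> 'v tree \<Rightarrow> bool" where
  "eval_tree x (Leaf i) \<longleftrightarrow> x i"
| "eval_tree x (Node g c) \<longleftrightarrow>
    (case g of And \<Rightarrow> \<forall>n. eval_tree x (c n) | Or \<Rightarrow> \<exists>n. eval_tree x (c n))"

text \<open>
  An element of \<open>2^I\<close> is an extensional function on \<open>I\<close>; values of \<open>f\<close> outside \<open>cube I\<close> are
  irrelevant whenever \<open>f\<close> represents a function on \<open>2^I\<close>.
\<close>

definition cube :: "nat set \<Rightarrow> (nat \<Rightarrow> bool) set"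
  where "cube I = I \<rightarrow>\<^sub>E UNIV"

lemma cube_UNIV: "cube UNIV = UNIV"
  by (auto simp: cube_def)

definition tree_function :: "nat set \<Rightarrow> omega1 \<Rightarrow> ((nat \<Rightarrow> bool) \<Rightarrow> bool) \<Rightarrow> bool"
  where "tree_function I a f \<longleftrightarrow>
    (\<exists>t. full a t \<and> inj_labelled t \<and> alternating t \<and> vars t \<subseteq> I \<and>
      (\<forall>x \<in> cube I. f x = eval_tree x t))"

section \<open>Restrictions\<close>

text \<open>\<^const>\<open>None\<close> stands for \<open>*\<close>.\<close>

type_synonym restriction = "nat \<Rightarrow> bool option"

definition free_vars :: "restriction \<Rightarrow> nat set"
  where "free_vars \<rho> = \<rho> -` {None}"

definition restricted :: "((nat \<Rightarrow> bool) \<Rightarrow> bool) \<Rightarrow> restriction \<Rightarrow> (nat \<Rightarrow> bool) \<Rightarrow> bool"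
  where "restricted f \<rho> x = f (\<lambda>i. case \<rho> i of None \<Rightarrow> x i | Some v \<Rightarrow> v)"

end

theory Submission
  imports Defs
begin

text \<open>
  The bottom \<open>\<alpha>\<close> levels of the tree \<open>T\<close> that computes \<open>g\<close> are collapsed, and the Borel sets out of
  which \<open>f\<close> is built become clopen on the way. Under a restriction, a subtree is settled if it has
  become a constant and live if it has become a single free variable. A restriction prunes \<open>T\<close> at
  \<open>a\<close> if, for every vertex of rank above \<open>a\<close>, each child of rank at most \<open>a\<close> is either settled at
  the value that the gate of its parent ignores, or is live of rank exactly \<open>a\<close>, and if infinitely
  many children of rank \<open>a\<close> stay live wherever there are any. What a restriction that prunes at
  \<open>\<alpha>\<close> leaves of a tree of rank \<open>\<alpha> + \<beta>\<close> is a full alternating tree of rank \<open>\<beta>\<close>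
  (\<open>residual_tree\<close>).

  The core is \<open>resolve\<close>: given countably many Borel sets, some restriction prunes \<open>T\<close> at \<open>a\<close>
  and makes all the sets of level at most \<open>a\<close> clopen. Its proof is by induction on \<open>a\<close>. The
  step has two halves. The first yields a restriction under which all sets of level below \<open>a\<close> are
  clopen and every vertex of rank \<open>a\<close> is a gate over infinitely many free variables, its other
  children being ignored (\<open>nearly_live_succ\<close>, \<open>nearly_live_limit\<close>). The sets of level \<open>a\<close>
  are then open, and the second half (\<open>collapse\<close>) makes them clopen while it reduces the vertices
  of rank \<open>a\<close> to single variables. A nonempty open set can be decided by fixing finitely many
  variables. Below such a vertex of rank \<open>a\<close>, a fixed variable is either ignored by that vertex, or it
  forces the vertex to the absorbing value of its gate; by alternation this is the value that the
  parent ignores. A decision therefore costs each parent only finitely many children.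

  Infinitely many decisions are combined by a fusion argument (\<open>fusion\<close>). Stages alternate between
  deciding a set and setting aside one variable \<open>v\<close>, which is fixed for the time being so that
  its subtree is ignored. A set is decided for every assignment of the finitely many variables set
  aside before, so it stays clopen when all these variables are released at the end; and each
  released variable is the only free one in its subtree. This is why the countable family of sets is
  taken to be closed under fixing finitely many coordinates.

  With \<open>a = \<alpha>\<close>, both preimages \<open>{x. f x}\<close> and \<open>{x. \<not> f x}\<close> are countable unions of sets that have
  become clopen, so they are open, and finitely many further variables decide \<open>f\<close>. They can be given
  the values that their parents ignore.
\<close>

section \<open>Overriding an input by a restriction\<close>

definition override :: "restriction \<Rightarrow> (nat \<Rightarrow> bool) \<Rightarrow> nat \<Rightarrow> bool"
  where "override \<rho> x i = (case \<rho> i of None \<Rightarrow> x i | Some b \<Rightarrow> b)"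

lemma override_None [simp]: "\<rho> i = None \<Longrightarrow> override \<rho> x i = x i"
  and override_Some [simp]: "\<rho> i = Some b \<Longrightarrow> override \<rho> x i = b"
  by (simp_all add: override_def)

lemma restricted_override: "restricted f \<rho> x = f (override \<rho> x)"
  by (simp add: restricted_def override_def[abs_def])

lemma override_empty [simp]: "override Map.empty x = x"
  by (simp add: override_def[abs_def])

lemma map_leD: "\<rho> \<subseteq>\<^sub>m \<rho>' \<Longrightarrow> \<rho> i = Some b \<Longrightarrow> \<rho>' i = Some b"
  by (metis domI map_le_def)

lemma override_map_le: "\<rho> \<subseteq>\<^sub>m \<rho>' \<Longrightarrow> override \<rho> (override \<rho>' x) = override \<rho>' x"
  by (rule ext) (auto simp: override_def map_leD split: option.splits)

lemma override_compose: "override p (override q x) = override (q ++ p) x"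
  by (rule ext) (auto simp: override_def split: option.splits)

lemma continuous_override: "continuous_on UNIV (override \<rho>)"
proof (rule continuous_on_coordinatewise_then_product)
  fix i
  show "continuous_on UNIV (\<lambda>x. override \<rho> x i)"
    by (cases "\<rho> i") (simp_all add: override_def)
qed

lemma finite_maps_on: "finite C \<Longrightarrow> finite {p :: restriction. dom p = C}"
  using finite_set_of_finite_maps[of C "UNIV :: bool set"] by simp

lemma countable_finite_maps: "countable {p :: restriction. finite (dom p)}"
proof -
  let ?M = "{p :: restriction. finite (dom p)}"
  have "inj_on Map.graph ?M"
  proof (rule inj_onI, rule ext)
    fix p q :: restriction and i assume "Map.graph p = Map.graph q"
    then show "p i = q i"
      by (metis in_graphD in_graphI not_None_eq)
  qed
  moreover have "Map.graph ` ?M \<subseteq> Collect finite"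
    by (simp add: image_subset_iff finite_graph_iff_finite_dom)
  then have "countable (Map.graph ` ?M)"
    by (rule countable_subset) (rule countable_Collect_finite)
  ultimately show ?thesis by (rule countable_image_inj_on[rotated])
qed

section \<open>Sets that become open or clopen under a restriction\<close>

definition open_under :: "restriction \<Rightarrow> (nat \<Rightarrow> bool) set \<Rightarrow> bool"
  where "open_under \<rho> S \<longleftrightarrow> open (override \<rho> -` S)"

definition clopen_under :: "restriction \<Rightarrow> (nat \<Rightarrow> bool) set \<Rightarrow> bool"
  where "clopen_under \<rho> S \<longleftrightarrow> open_under \<rho> S \<and> open_under \<rho> (- S)"

lemma open_under_mono:
  assumes "open_under \<rho> S" "\<rho> \<subseteq>\<^sub>m \<rho>'"
  shows "open_under \<rho>' S"
proof -
  have "override \<rho>' -` S = override \<rho>' -` (override \<rho> -` S)"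
    using override_map_le[OF assms(2)] by (auto simp: vimage_def)
  then show ?thesis
    using assms(1) continuous_override by (simp add: open_under_def open_vimage)
qed

lemma clopen_under_mono: "clopen_under \<rho> S \<Longrightarrow> \<rho> \<subseteq>\<^sub>m \<rho>' \<Longrightarrow> clopen_under \<rho>' S"
  by (auto simp: clopen_under_def open_under_mono)

lemma open_under_UN: "(\<And>m. open_under \<rho> (S m)) \<Longrightarrow> open_under \<rho> (\<Union>m. S m)"
  by (auto simp: open_under_def vimage_UN)

lemma open_coordinate: "open {x :: nat \<Rightarrow> bool. x i = b}"
proof -
  have "continuous_on UNIV (\<lambda>x :: nat \<Rightarrow> bool. x i)" by simp
  then have "open ((\<lambda>x :: nat \<Rightarrow> bool. x i) -` {b})"
    by (rule open_vimage[OF open_discrete])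
  then show ?thesis by (simp only: vimage_def singleton_iff)
qed

lemma override_fixed_iff: "override p x = x \<longleftrightarrow> (\<forall>i\<in>dom p. x i = the (p i))"
proof
  assume fixed: "override p x = x"
  show "\<forall>i\<in>dom p. x i = the (p i)"
  proof
    fix i assume "i \<in> dom p"
    then show "x i = the (p i)" using fun_cong[OF fixed, of i] by (auto simp: override_def)
  qed
next
  assume agree: "\<forall>i\<in>dom p. x i = the (p i)"
  show "override p x = x"
  proof
    fix i
    show "override p x i = x i"
      using agree by (cases "p i") (simp_all add: override_def dom_def)
  qed
qed

lemma open_override_fixed:
  assumes "finite (dom p)"
  shows "open {x. override p x = x}"
proof -
  have "open (\<Inter>i\<in>dom p. {x. x i = the (p i)})"
    by (rule open_INT[OF assms]) (rule ballI, rule open_coordinate)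
  moreover have "(\<Inter>i\<in>dom p. {x. x i = the (p i)}) = {x. override p x = x}"
    by (simp add: override_fixed_iff INTER_eq)
  ultimately show ?thesis by simp
qed

text \<open>
  Releasing the finitely many coordinates in \<open>C\<close> is harmless once every assignment to them has
  been dealt with: the input space splits into finitely many clopen cylinders, one for each \<open>p\<close>.
\<close>

lemma open_under_release:
  assumes C: "finite C" and S: "\<And>p. dom p = C \<Longrightarrow> open_under \<rho> (override p -` S)"
  shows "open_under (\<rho> |` (- C)) S"
proof -
  have eq: "override (\<rho> |` (- C)) x = override p (override \<rho> x)"
    if "dom p = C" "override p x = x" for p x
  proof
    fix i
    show "override (\<rho> |` (- C)) x i = override p (override \<rho> x) i"
    proof (cases "p i")
      case None
      then have "i \<notin> C" using that(1) by auto
      then show ?thesis using None by (simp add: override_def restrict_map_def)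
    next
      case (Some b)
      then have "i \<in> C" "x i = b"
        using that(1) fun_cong[OF that(2), of i] by auto
      then show ?thesis using Some by (simp add: override_def restrict_map_def)
    qed
  qed
  have "override (\<rho> |` (- C)) -` S =
    (\<Union>p\<in>{p. dom p = C}. {x. override p x = x} \<inter> override \<rho> -` (override p -` S))"
    (is "?L = ?R")
  proof (intro equalityI subsetI)
    fix x assume x: "x \<in> ?L"
    define p where "p = (\<lambda>i. if i \<in> C then Some (x i) else None)"
    have p: "dom p = C" by (simp add: p_def dom_def)
    have fixed: "override p x = x" by (rule ext) (simp add: override_def p_def)
    show "x \<in> ?R"
      using x eq[OF p fixed] p fixed by (intro UN_I[of p]) simp_all
  next
    fix x assume "x \<in> ?R"
    then obtain p where p: "dom p = C" "override p x = x" "override p (override \<rho> x) \<in> S"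
      by (elim UN_E) simp
    then show "x \<in> ?L"
      using eq[OF p(1,2)] by simp
  qed
  moreover have "open ({x. override p x = x} \<inter> override \<rho> -` (override p -` S))"
    if "dom p = C" for p
    using S[OF that] open_override_fixed[of p] C that by (simp add: open_under_def open_Int)
  ultimately show ?thesis
    by (simp add: open_under_def open_UN)
qed

lemma clopen_under_release:
  assumes "finite C" "\<And>p. dom p = C \<Longrightarrow> clopen_under \<rho> (override p -` S)"
  shows "clopen_under (\<rho> |` (- C)) S"
  using assms open_under_release[of C \<rho> S] open_under_release[of C \<rho> "- S"]
  by (auto simp: clopen_under_def vimage_Compl)

lemma open_finite_support:
  assumes "open U" "(x :: nat \<Rightarrow> bool) \<in> U"
  obtains D where "finite D" "\<And>y. (\<And>i. i \<in> D \<Longrightarrow> y i = x i) \<Longrightarrow> y \<in> U"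
proof -
  obtain X where X: "x \<in> PiE UNIV X" "finite {i. X i \<noteq> UNIV}" "PiE UNIV X \<subseteq> U"
    using product_topology_open_contains_basis[of "\<lambda>_. euclidean" UNIV U x] assms
    by (auto simp: open_fun_def)
  show thesis
  proof (rule that[OF X(2)])
    fix y assume y: "\<And>i. i \<in> {i. X i \<noteq> UNIV} \<Longrightarrow> y i = x i"
    have "y i \<in> X i" for i
      using y[of i] X(1) by (cases "X i = UNIV") (auto simp: PiE_def Pi_def)
    then show "y \<in> U" using X(3) by (auto simp: PiE_def Pi_def)
  qed
qed

text \<open>
  Finitely many coordinates of \<open>x\<close> force membership in the open set. They are fixed one at a time,
  and a step may fix further coordinates, provided that all the new values are those of \<open>x\<close>; this
  is what \<open>override \<rho>' x = override \<rho> x\<close> says.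
\<close>

lemma extend_towards:
  assumes step: "\<And>\<rho> i. Q \<rho> \<Longrightarrow> \<rho> i = None \<Longrightarrow>
      \<exists>\<rho>'. \<rho> \<subseteq>\<^sub>m \<rho>' \<and> i \<in> dom \<rho>' \<and> override \<rho>' x = override \<rho> x \<and> Q \<rho>'"
    and Q: "Q \<rho>" and S: "open_under \<rho> S" and x: "override \<rho> x \<in> S"
  shows "\<exists>\<rho>'. \<rho> \<subseteq>\<^sub>m \<rho>' \<and> Q \<rho>' \<and> (\<forall>y. override \<rho>' y \<in> S)"
proof -
  obtain D where D: "finite D" "\<And>y. (\<And>i. i \<in> D \<Longrightarrow> y i = x i) \<Longrightarrow> y \<in> override \<rho> -` S"
    using open_finite_support[of "override \<rho> -` S" x] S x by (auto simp: open_under_def)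
  have "\<exists>\<rho>'. \<rho> \<subseteq>\<^sub>m \<rho>' \<and> E \<subseteq> dom \<rho>' \<and> override \<rho>' x = override \<rho> x \<and> Q \<rho>'" if "finite E" for E
    using that
  proof induction
    case empty
    then show ?case using Q by (intro exI[of _ \<rho>]) simp
  next
    case (insert i E)
    then obtain \<rho>1 where 1: "\<rho> \<subseteq>\<^sub>m \<rho>1" "E \<subseteq> dom \<rho>1" "override \<rho>1 x = override \<rho> x" "Q \<rho>1" by auto
    show ?case
    proof (cases "\<rho>1 i")
      case None
      then obtain \<rho>2 where 2: "\<rho>1 \<subseteq>\<^sub>m \<rho>2" "i \<in> dom \<rho>2" "override \<rho>2 x = override \<rho>1 x" "Q \<rho>2"
        using step[OF 1(4)] by blast
      have "\<rho> \<subseteq>\<^sub>m \<rho>2" using 1(1) 2(1) by (rule map_le_trans)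
      moreover have "insert i E \<subseteq> dom \<rho>2" using 1(2) 2(2) map_le_implies_dom_le[OF 2(1)] by blast
      ultimately show ?thesis using 2(3,4) 1(3) by auto
    next
      case (Some b)
      then show ?thesis using 1 by auto
    qed
  qed
  from this[OF D(1)] obtain \<rho>' where
    \<rho>': "\<rho> \<subseteq>\<^sub>m \<rho>'" "D \<subseteq> dom \<rho>'" "override \<rho>' x = override \<rho> x" "Q \<rho>'" by auto
  have "override \<rho>' y \<in> S" for y
  proof -
    define z where "z = (\<lambda>i. if i \<in> D then x i else override \<rho>' y i)"
    have "override \<rho> z i = override \<rho>' y i" for i
    proof (cases "\<rho> i")
      case None
      show ?thesis
      proof (cases "i \<in> D")
        case True
        then obtain b where "\<rho>' i = Some b" using \<rho>'(2) by auto
        then show ?thesis using None True fun_cong[OF \<rho>'(3), of i] by (simp add: z_def)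
      next
        case False
        then show ?thesis using None by (simp add: z_def)
      qed
    next
      case (Some b)
      then show ?thesis using map_leD[OF \<rho>'(1) Some] by simp
    qed
    then have "override \<rho> z = override \<rho>' y" by auto
    moreover have "override \<rho> z \<in> S" using D(2)[of z] by (simp add: z_def)
    ultimately show ?thesis by simp
  qed
  then show ?thesis using \<rho>' by blast
qed

section \<open>Countable families of Borel sets closed under their own construction\<close>

text \<open>
  The two kinds of Borel classes are reduced to one by representing a \<open>\<Pi>\<close> set by its complement,
  so that a set of level \<open>a\<close> is a union of complements of sets of lower level.
\<close>

definition built_from :: "(omega1 \<times> (nat \<Rightarrow> bool) set) set \<Rightarrow> omega1 \<Rightarrow> (nat \<Rightarrow> bool) set \<Rightarrow> bool"
  where "built_from \<S> a S \<longleftrightarrow> a = 0 \<and> open S \<and> closed S \<or>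
    (\<exists>B :: nat \<Rightarrow> (nat \<Rightarrow> bool) set. S = (\<Union>m. - B m) \<and> (\<forall>m. \<exists>b<a. (b, B m) \<in> \<S>))"

definition borel_family :: "(omega1 \<times> (nat \<Rightarrow> bool) set) set \<Rightarrow> bool"
  where "borel_family \<S> \<longleftrightarrow> (\<forall>a S. (a, S) \<in> \<S> \<longrightarrow> built_from \<S> a S)"

lemma built_fromI:
  fixes B :: "nat \<Rightarrow> (nat \<Rightarrow> bool) set"
  assumes "S = (\<Union>m. - B m)" "\<And>m. \<exists>b<a. (b, B m) \<in> \<S>"
  shows "built_from \<S> a S"
  unfolding built_from_def by (intro disjI2 exI[of _ B]) (use assms in simp)

lemma built_from_mono: "built_from \<S> a S \<Longrightarrow> \<S> \<subseteq> \<S>' \<Longrightarrow> built_from \<S>' a S"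
  unfolding built_from_def subset_iff by metis

lemma borel_family_Union:
  assumes "\<And>\<S>. \<S> \<in> \<X> \<Longrightarrow> borel_family \<S>"
  shows "borel_family (\<Union>\<X>)"
  unfolding borel_family_def
proof (intro allI impI)
  fix a S assume "(a, S) \<in> \<Union>\<X>"
  then obtain \<S> where \<S>: "\<S> \<in> \<X>" "(a, S) \<in> \<S>" by blast
  then have "built_from \<S> a S" using assms[of \<S>] by (simp add: borel_family_def)
  then show "built_from (\<Union>\<X>) a S" by (rule built_from_mono) (use \<S> in blast)
qed

lemma borel_family_insert:
  assumes "borel_family \<S>" "\<And>m :: nat. \<exists>b<a. (b, B m) \<in> \<S>"
  shows "borel_family (insert (a, \<Union>m. - B m) \<S>)"
  unfolding borel_family_def
proof (intro allI impI)
  fix c S assume c: "(c, S) \<in> insert (a, \<Union>m. - B m) \<S>"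
  have "built_from \<S> a (\<Union>m. - B m)"
    by (rule built_fromI[OF refl assms(2)])
  then have "built_from \<S> c S"
    using c assms(1) by (auto simp: borel_family_def)
  then show "built_from (insert (a, \<Union>m. - B m) \<S>) c S"
    by (rule built_from_mono) blast
qed

lemma Sigma0_borel_family:
  "Sigma0 a S \<Longrightarrow> \<exists>\<S>. countable \<S> \<and> borel_family \<S> \<and> (a, S) \<in> \<S>"
  "Pi0 a S \<Longrightarrow> \<exists>\<S>. countable \<S> \<and> borel_family \<S> \<and> (a, - S) \<in> \<S>"
proof (induction rule: Sigma0_Pi0.inducts)
  case (Sigma0_clopen S)
  then show ?case by (intro exI[of _ "{(0, S)}"]) (simp add: borel_family_def built_from_def)
next
  case (Pi0_clopen S)
  then show ?case by (intro exI[of _ "{(0, - S)}"]) (simp add: borel_family_def built_from_def open_Compl closed_Compl)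
next
  case (Sigma0_Union b a S)
  then obtain F where F: "\<And>n. countable (F n)" "\<And>n. borel_family (F n)" "\<And>n. (b n, - S n) \<in> F n"
    by metis
  have "borel_family (\<Union>(range F))" using F(2) by (intro borel_family_Union) auto
  then have "borel_family (insert (a, \<Union>n. - (- S n)) (\<Union>(range F)))"

  proof (rule borel_family_insert)
    show "\<exists>c<a. (c, - S n) \<in> \<Union>(range F)" for n
      using F(3)[of n] Sigma0_Union[of n] by (intro exI[of _ "b n"]) auto
  qed
  then show ?case using F(1)
    by (intro exI[of _ "insert (a, \<Union>n. - (- S n)) (\<Union>(range F))"]) simp
next
  case (Pi0_Inter b a S)
  then obtain F where F: "\<And>n. countable (F n)" "\<And>n. borel_family (F n)" "\<And>n. (b n, S n) \<in> F n"
    by metis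
  have "borel_family (\<Union>(range F))" using F(2) by (intro borel_family_Union) auto
  then have "borel_family (insert (a, \<Union>n. - S n) (\<Union>(range F)))"

  proof (rule borel_family_insert)
    show "\<exists>c<a. (c, S n) \<in> \<Union>(range F)" for n
      using F(3)[of n] Pi0_Inter[of n] by (intro exI[of _ "b n"]) auto
  qed
  then show ?case using F(1)
    by (intro exI[of _ "insert (a, \<Union>n. - S n) (\<Union>(range F))"]) simp
qed

definition stable_family :: "(omega1 \<times> (nat \<Rightarrow> bool) set) set \<Rightarrow> bool"
  where "stable_family \<S> \<longleftrightarrow> countable \<S> \<and> borel_family \<S> \<and>
    (\<forall>a S p. (a, S) \<in> \<S> \<longrightarrow> finite (dom p) \<longrightarrow> (a, override p -` S) \<in> \<S>)"

lemma stable_family_exists: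
  assumes "countable \<S>" "borel_family \<S>"
  obtains \<S>' where "stable_family \<S>'" "\<S> \<subseteq> \<S>'"
proof -
  define \<S>' where
    "\<S>' = (\<lambda>((a, S), p). (a, override p -` S)) ` (\<S> \<times> {p :: restriction. finite (dom p)})"
  have in_family: "(a, override p -` S) \<in> \<S>'" if "(a, S) \<in> \<S>" "finite (dom p)" for a S p
    unfolding \<S>'_def using that by force
  have "countable \<S>'"
    unfolding \<S>'_def using assms(1) countable_finite_maps by (intro countable_image countable_SIGMA)
  moreover have "borel_family \<S>'"
    unfolding borel_family_def
  proof (intro allI impI)
    fix a S' assume "(a, S') \<in> \<S>'"
    then obtain S p where S: "(a, S) \<in> \<S>" "finite (dom p)" "S' = override p -` S"
      by (auto simp: \<S>'_def)
    have "built_from \<S> a S" using assms(2) S(1) by (simp add: borel_family_def)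
    then consider "a = 0" "open S" "closed S"
      | B :: "nat \<Rightarrow> _" where "S = (\<Union>m. - B m)" "\<forall>m. \<exists>b<a. (b, B m) \<in> \<S>"
      unfolding built_from_def by blast
    then show "built_from \<S>' a S'"
    proof cases
      case 1
      then show ?thesis
        using S(3) continuous_override[of p] by (simp add: built_from_def open_vimage closed_vimage)
    next
      case 2
      show ?thesis
      proof (rule built_fromI)
        show "S' = (\<Union>m. - (override p -` B m))" by (simp add: S(3) 2(1) vimage_UN vimage_Compl)
        show "\<exists>b<a. (b, override p -` B m) \<in> \<S>'" for m
        proof -
          obtain b where "b < a" "(b, B m) \<in> \<S>" using 2(2) by blast
          then show ?thesis using in_family S(2) by blast
        qed
      qed
    qed
  qed
  moreover have "(a, override q -` S') \<in> \<S>'" if S': "(a, S') \<in> \<S>'" and q: "finite (dom q)" for a S' q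
  proof -
    obtain S p where S: "(a, S) \<in> \<S>" "finite (dom p)" "S' = override p -` S"
      using S' by (auto simp: \<S>'_def)
    have "override q -` S' = override (q ++ p) -` S"
      by (auto simp: S(3) override_compose)
    then show ?thesis using in_family[OF S(1), of "q ++ p"] S(2) q by simp
  qed
  moreover have "\<S> \<subseteq> \<S>'"
  proof
    fix s assume "s \<in> \<S>"
    then show "s \<in> \<S>'" using in_family[of "fst s" "snd s" Map.empty] by (simp add: vimage_def)
  qed
  ultimately show thesis
    by (intro that[of \<S>']) (simp_all add: stable_family_def)
qed

lemma borel_family_open_under:
  assumes "borel_family \<S>" "(a, S) \<in> \<S>"
    and clopen: "\<And>b B. b < a \<Longrightarrow> (b, B) \<in> \<S> \<Longrightarrow> clopen_under \<rho> B"
  shows "open_under \<rho> S"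
proof -
  have "built_from \<S> a S" using assms(1,2) by (simp add: borel_family_def)
  then consider "open S" | B :: "nat \<Rightarrow> _" where "S = (\<Union>m. - B m)" "\<forall>m. \<exists>b<a. (b, B m) \<in> \<S>"
    unfolding built_from_def by blast
  then show ?thesis
  proof cases
    case 1
    then show ?thesis using continuous_override[of \<rho>] by (simp add: open_under_def open_vimage)
  next
    case 2
    then have "open_under \<rho> (- B m)" for m
      using clopen unfolding clopen_under_def by blast
    then show ?thesis unfolding 2(1) by (rule open_under_UN)
  qed
qed

section \<open>Addition of countable ordinals\<close>

lemma add_strict_mono_omega1: "d < b \<Longrightarrow> a + d < a + (b :: omega1)"
  using add_le_omega1_iff[of a b "a + b"] by auto

lemma add_less_cancel_omega1 [simp]: "a + d < a + b \<longleftrightarrow> d < (b :: omega1)"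
  by (metis add_strict_mono_omega1 not_less_iff_gr_or_eq)

lemma add_left_cancel_omega1 [simp]: "a + d = a + b \<longleftrightarrow> d = (b :: omega1)"
  by (metis add_strict_mono_omega1 not_less_iff_gr_or_eq order_less_irrefl)

lemma le_add_left_omega1: "b \<le> a + (b :: omega1)"
proof (induction b rule: less_induct)
  case (less b)
  then have "d < a + b" if "d < b" for d
    using that add_strict_mono_omega1[OF that, of a] by (meson order_le_less_trans)
  then show ?case by (metis not_le order_less_irrefl)
qed

lemma le_omega1_obtains_diff:
  assumes "a \<le> (c :: omega1)"
  obtains b where "c = a + b"
proof -
  define b where "b = (LEAST b. c \<le> a + b)"
  have ge: "c \<le> a + b" unfolding b_def using le_add_left_omega1 by (rule LeastI)
  have "a + d < c" if "d < b" for d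
    using not_less_Least[of d "\<lambda>b. c \<le> a + b"] that by (simp add: b_def)
  then have "a + b \<le> c" using assms by (simp add: add_le_omega1_iff)
  then show thesis using ge by (intro that[of b]) simp
qed

lemma succ_inject_omega1 [simp]: "a + 1 = b + 1 \<longleftrightarrow> a = (b :: omega1)"
  by (metis less_succ_omega1_iff order.antisym order.refl)

lemma not_limit_succ_omega1 [simp]: "\<not> limit_omega1 (b + 1)"
  by (auto simp: limit_omega1_def)

text \<open>
  The sequence starts at a prescribed \<open>c\<close>, so that it can drive an iteration that is already at
  stage \<open>c\<close>.
\<close>

lemma limit_cofinal_sequence:
  assumes "limit_omega1 a" "c < a"
  obtains d :: "nat \<Rightarrow> omega1" where "d 0 = c" "\<And>i. d i \<le> d (Suc i)" "\<And>i. d i < a"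
    "\<And>b. b < a \<Longrightarrow> \<exists>i. b < d i"
proof -
  have succ_less: "b + 1 < a" if "b < a" for b
    using that assms(1) by (metis limit_omega1_def order_le_less succ_le_omega1_iff)
  define e where "e = from_nat_into {..<a}"
  have e: "e i < a" for i
    using from_nat_into[of "{..<a}" i] assms(2) by (auto simp: e_def)
  define d where "d = rec_nat c (\<lambda>i x. max x (e i + 1))"
  have d: "d 0 = c" "d (Suc i) = max (d i) (e i + 1)" for i by (simp_all add: d_def)
  have "d i < a" for i by (induction i) (simp_all add: d assms(2) succ_less e)
  moreover have "\<exists>i. b < d i" if b: "b < a" for b
  proof -
    obtain i where "e i = b"
      using from_nat_into_surj[OF countable_lessThan_omega1, of b a] b by (auto simp: e_def)
    then have "b < d (Suc i)" by (auto simp: d less_max_iff_disj less_succ_omega1_iff)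
    then show ?thesis ..
  qed
  ultimately show thesis by (intro that[of d]) (simp_all add: d)
qed

section \<open>Vertices, ranks and cuts of a tree\<close>

primrec subtrees :: "'v tree \<Rightarrow> 'v tree set" where
  "subtrees (Leaf i) = {Leaf i}"
| "subtrees (Node g c) = insert (Node g c) (\<Union>n. subtrees (c n))"

primrec tree_rank :: "'v tree \<Rightarrow> omega1" where
  "tree_rank (Leaf i) = 0"
| "tree_rank (Node g c) = (LEAST a. \<forall>n. tree_rank (c n) < a)"

declare tree_rank.simps(2) [simp del]

lemma tree_rank_child: "tree_rank (c n) < tree_rank (Node g c)"
proof -
  obtain u where "\<And>a. a \<in> range (\<lambda>n. tree_rank (c n)) \<Longrightarrow> a < u"
    using countable_bounded_omega1[of "range (\<lambda>n. tree_rank (c n))"] by auto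
  then have "\<forall>n. tree_rank (c n) < u" by auto
  then have "\<forall>n. tree_rank (c n) < tree_rank (Node g c)"
    unfolding tree_rank.simps(2) by (rule LeastI)
  then show ?thesis ..
qed

lemma tree_rank_least: "(\<And>n. tree_rank (c n) < a) \<Longrightarrow> tree_rank (Node g c) \<le> a"
  unfolding tree_rank.simps(2) by (simp add: Least_le)

lemma self_in_subtrees [simp]: "t \<in> subtrees t"
  by (cases t) auto

lemma subtrees_child: "Node g c \<in> subtrees t \<Longrightarrow> c n \<in> subtrees t"
proof (induction t)
  case (Node h d)
  show ?case
  proof (cases "Node g c = Node h d")
    case True
    then have "c n \<in> subtrees (d n)" by simp
    then show ?thesis by auto
  next
    case False
    then obtain m where "Node g c \<in> subtrees (d m)" using Node.prems by auto
    then have "c n \<in> subtrees (d m)" using Node.IH[of "d m"] by simp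
    then show ?thesis by auto
  qed
qed simp

lemma subtrees_parent:
  "u \<in> subtrees t \<Longrightarrow> u \<noteq> t \<Longrightarrow> \<exists>g c n. Node g c \<in> subtrees t \<and> c n = u"
proof (induction t)
  case (Node h d)
  then obtain m where m: "u \<in> subtrees (d m)" by auto
  show ?case
  proof (cases "u = d m")
    case True
    then show ?thesis by auto
  next
    case False
    then obtain g c n where "Node g c \<in> subtrees (d m)" "c n = u"
      using Node.IH[of "d m"] m by auto
    then show ?thesis by auto
  qed
qed simp

lemma vars_subtrees: "u \<in> subtrees t \<Longrightarrow> vars u \<subseteq> vars t"
  by (induction t) auto

lemma tree_rank_subtrees: "u \<in> subtrees t \<Longrightarrow> tree_rank u \<le> tree_rank t"
proof (induction t)
  case (Node h d)
  show ?case
  proof (cases "u = Node h d")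
    case False
    then obtain m where "u \<in> subtrees (d m)" using Node.prems by auto
    then have "tree_rank u \<le> tree_rank (d m)" using Node.IH[of "d m"] by simp
    also have "\<dots> < tree_rank (Node h d)" by (rule tree_rank_child)
    finally show ?thesis by simp
  qed simp
qed simp

lemma countable_subtrees: "countable (subtrees t)"
  by (induction t) auto

lemma inj_labelled_subtrees: "u \<in> subtrees t \<Longrightarrow> inj_labelled t \<Longrightarrow> inj_labelled u"
  by (induction t) auto

lemma alternating_subtrees: "u \<in> subtrees t \<Longrightarrow> alternating t \<Longrightarrow> alternating u"
  by (induction t) auto

text \<open>
  The edges along which the rank drops from above \<open>a\<close> to at most \<open>a\<close>, represented by the gate and the
  children of the upper vertex and the index of the lower one. If the rank of \<open>t\<close> exceeds
  \<open>a\<close>, every branch crosses exactly one of them, so the subtrees below the cut partition the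
  variables (\<open>cut_unique\<close>, \<open>cut_cover\<close>).
\<close>

definition cut :: "'v tree \<Rightarrow> omega1 \<Rightarrow> (gate \<times> (nat \<Rightarrow> 'v tree) \<times> nat) set"
  where "cut t a =
    {(g, c, n). Node g c \<in> subtrees t \<and> a < tree_rank (Node g c) \<and> tree_rank (c n) \<le> a}"

lemma in_cut_iff:
  "(g, c, n) \<in> cut t a \<longleftrightarrow> Node g c \<in> subtrees t \<and> a < tree_rank (Node g c) \<and> tree_rank (c n) \<le> a"
  by (simp add: cut_def)

lemma cut_Node_cases:
  assumes "(g, c, n) \<in> cut (Node h d) a"
  obtains "g = h" "c = d" "tree_rank (d n) \<le> a"
  | m where "(g, c, n) \<in> cut (d m) a" "a < tree_rank (d m)" "vars (c n) \<subseteq> vars (d m)"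
proof (cases "Node g c = Node h d")
  case True
  then show ?thesis using assms that(1) by (auto simp: in_cut_iff)
next
  case False
  then obtain m where m: "Node g c \<in> subtrees (d m)" using assms by (auto simp: in_cut_iff)
  then have "a < tree_rank (d m)"
    using assms tree_rank_subtrees[OF m] by (auto simp: in_cut_iff)
  then show ?thesis
    using that(2)[of m] assms m vars_subtrees[OF subtrees_child[OF m, of n]] by (simp add: in_cut_iff)
qed

lemma cut_unique:
  assumes "inj_labelled t" "(g, c, n) \<in> cut t a" "(g', c', n') \<in> cut t a"
    and "v \<in> vars (c n)" "v \<in> vars (c' n')"
  shows "g' = g" "c' = c" "n' = n"
proof -
  have "g' = g \<and> c' = c \<and> n' = n"
    using assms
  proof (induction t)
    case (Node h d)
    have disj: "k = m" if "v \<in> vars (d k)" "v \<in> vars (d m)" for k m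
      using Node.prems(1) that by (auto simp: disjoint_family_on_def)
    show ?case
    proof (rule cut_Node_cases[OF Node.prems(2)])
      assume 1: "g = h" "c = d" "tree_rank (d n) \<le> a"
      show ?case
      proof (rule cut_Node_cases[OF Node.prems(3)])
        fix m assume "(g', c', n') \<in> cut (d m) a" "a < tree_rank (d m)" "vars (c' n') \<subseteq> vars (d m)"
        then show ?case using disj[of n m] 1 Node.prems(4,5) by auto
      qed (use disj[of n n'] 1 Node.prems in auto)
    next
      fix m assume 1: "(g, c, n) \<in> cut (d m) a" "a < tree_rank (d m)" "vars (c n) \<subseteq> vars (d m)"
      show ?case
      proof (rule cut_Node_cases[OF Node.prems(3)])
        assume "g' = h" "c' = d" "tree_rank (d n') \<le> a"
        then show ?case using disj[of n' m] 1 Node.prems(4,5) by auto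
      next
        fix k assume 2: "(g', c', n') \<in> cut (d k) a" "a < tree_rank (d k)" "vars (c' n') \<subseteq> vars (d k)"
        then have "k = m" using disj[of k m] 1 Node.prems(4,5) by auto
        then show ?case using Node.IH[of "d m"] 1 2 Node.prems by simp
      qed
    qed
  qed (simp add: cut_def)
  then show "g' = g" "c' = c" "n' = n" by simp_all
qed

lemma cut_cover:
  "v \<in> vars t \<Longrightarrow> a < tree_rank t \<Longrightarrow> \<exists>g c n. (g, c, n) \<in> cut t a \<and> v \<in> vars (c n)"
proof (induction t)
  case (Leaf i)
  then show ?case using zero_le_omega1[of a] by simp
next
  case (Node h d)
  then obtain m where m: "v \<in> vars (d m)" by auto
  show ?case
  proof (cases "a < tree_rank (d m)")
    case True
    then obtain g c n where "(g, c, n) \<in> cut (d m) a" "v \<in> vars (c n)"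
      using Node.IH[of "d m"] m by auto
    then show ?thesis by (auto simp: in_cut_iff)
  next
    case False
    then have "(h, d, m) \<in> cut (Node h d) a" using Node.prems by (simp add: in_cut_iff)
    then show ?thesis using m by blast
  qed
qed

lemma cut_of_vertex:
  assumes "u \<in> subtrees t" "tree_rank u < tree_rank t"
  obtains g c n where "(g, c, n) \<in> cut t (tree_rank u)" "c n = u"
proof -
  obtain g c n where "Node g c \<in> subtrees t" "c n = u"
    using subtrees_parent[OF assms(1)] assms(2) by auto
  then show thesis using that[of g c n] tree_rank_child[of c n g] by (simp add: in_cut_iff)
qed

lemma countable_cut: "countable (cut t a)"
proof -
  have "inj_on (\<lambda>(g, c, n :: nat). (Node g c, n)) (cut t a)" by (auto simp: inj_on_def)
  moreover have "countable ((\<lambda>(g, c, n). (Node g c, n)) ` cut t a)"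
    by (rule countable_subset[of _ "subtrees t \<times> UNIV"])
      (auto simp: in_cut_iff countable_subtrees)
  ultimately show ?thesis by (rule countable_image_inj_on[rotated])
qed

lemma tree_rank_full: "full a t \<Longrightarrow> tree_rank t = a"
proof (induction rule: full.induct)
  case (full_succ a c g)
  then have "tree_rank (Node g c) \<le> a + 1"
    by (intro tree_rank_least) (simp add: less_succ_omega1_iff)
  moreover have "a + 1 \<le> tree_rank (Node g c)"
    using full_succ tree_rank_child[of c 0 g] by (simp add: succ_le_omega1_iff)
  ultimately show ?case by simp
next
  case (full_limit a b c g)
  have le: "tree_rank (Node g c) \<le> a"
    using full_limit by (intro tree_rank_least) simp
  have "\<not> tree_rank (Node g c) < a"
  proof
    assume "tree_rank (Node g c) < a"
    then obtain n where "b n = tree_rank (Node g c)"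
      using full_limit.hyps(2) full_limit by (metis (mono_tags, lifting) Collect_empty_eq finite.emptyI)
    then show False using full_limit tree_rank_child[of c n g] by auto
  qed
  then show ?case using le by simp
qed simp

lemma full_Node_cases:
  assumes "full a (Node g c)"
  obtains b where "a = b + 1" "\<And>n. full b (c n)"
  | "limit_omega1 a" "\<And>n. full (tree_rank (c n)) (c n)" "\<And>d. d < a \<Longrightarrow> infinite {n. tree_rank (c n) = d}"
  using assms
proof (cases rule: full.cases)
  case (full_succ b)
  then show ?thesis using that(1) by blast
next
  case (full_limit b)
  have "b n = tree_rank (c n)" for n
    using full_limit(2)[of n] tree_rank_full by metis
  then show ?thesis using that(2) full_limit by simp
qed

lemma full_child: "full a (Node g c) \<Longrightarrow> full (tree_rank (c n)) (c n)"
  by (erule full_Node_cases) (metis tree_rank_full)+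

lemma full_subtrees: "full a t \<Longrightarrow> u \<in> subtrees t \<Longrightarrow> full (tree_rank u) u"
proof (induction t arbitrary: a)
  case (Leaf i)
  then show ?case using tree_rank_full by fastforce
next
  case (Node h d)
  show ?case
  proof (cases "u = Node h d")
    case True
    then show ?thesis using Node.prems tree_rank_full by metis
  next
    case False
    then obtain m where "u \<in> subtrees (d m)" using Node.prems by auto
    then show ?thesis using Node.IH[of "d m"] full_child[OF Node.prems(1), of m] by simp
  qed
qed

lemma full_infinite_siblings:
  assumes "full a (Node g c)"
  shows "infinite {m. tree_rank (c m) = tree_rank (c n)}"
proof (rule full_Node_cases[OF assms])
  fix b assume children: "\<And>n. full b (c n)"
  show ?thesis by (simp add: tree_rank_full[OF children])
next
  assume "\<And>d. d < a \<Longrightarrow> infinite {n. tree_rank (c n) = d}"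
  then show ?thesis using tree_rank_child[of c n g] tree_rank_full[OF assms] by simp
qed

lemma full_cut_exists:
  "full b t \<Longrightarrow> a < b \<Longrightarrow> \<exists>g c n. (g, c, n) \<in> cut t a \<and> tree_rank (c n) = a"
proof (induction t arbitrary: b)
  case (Leaf i)
  then show ?case using tree_rank_full[of b "Leaf i"] zero_le_omega1[of a] by auto
next
  case (Node h d)
  have rk: "tree_rank (Node h d) = b" using Node.prems(1) by (rule tree_rank_full)
  show ?case
  proof (rule full_Node_cases[OF Node.prems(1)])
    fix b' assume b': "b = b' + 1" "\<And>n. full b' (d n)"
    show ?case
    proof (cases "a = b'")
      case True
      then have "(h, d, 0) \<in> cut (Node h d) a \<and> tree_rank (d 0) = a"
        using b' rk Node.prems(2) by (simp add: in_cut_iff tree_rank_full[OF b'(2)])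
      then show ?thesis by blast
    next
      case False
      then have "a < b'" using Node.prems(2) b'(1) by (simp add: less_succ_omega1_iff)
      then obtain g c n where "(g, c, n) \<in> cut (d 0) a \<and> tree_rank (c n) = a"
        using Node.IH[of "d 0" b'] b'(2) by auto
      then show ?thesis by (auto simp: in_cut_iff)
    qed
  next
    assume "\<And>d'. d' < b \<Longrightarrow> infinite {n. tree_rank (d n) = d'}"
    then have "infinite {n. tree_rank (d n) = a}" using Node.prems(2) by simp
    then obtain n where "tree_rank (d n) = a" using not_finite_existsD by auto
    then have "(h, d, n) \<in> cut (Node h d) a \<and> tree_rank (d n) = a"
      using rk Node.prems(2) by (simp add: in_cut_iff)
    then show ?thesis by blast
  qed
qed

section \<open>Evaluation under a restriction\<close>

text \<open>
  The value of a child that does not affect the gate; its negation is absorbing.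
\<close>

definition neutral :: "gate \<Rightarrow> bool"
  where "neutral g \<longleftrightarrow> g = And"

lemma eval_tree_Node:
  "eval_tree x (Node g c) = (if \<forall>n. eval_tree x (c n) = neutral g then neutral g else \<not> neutral g)"
  by (cases g) (auto simp: neutral_def)

lemma eval_tree_cong: "(\<And>i. i \<in> vars t \<Longrightarrow> x i = y i) \<Longrightarrow> eval_tree x t = eval_tree y t"
proof (induction t)
  case (Node g c)
  have "eval_tree x (c n) = eval_tree y (c n)" for n
    using Node.IH[of "c n"] Node.prems by auto
  then show ?case by (simp add: eval_tree_Node del: eval_tree.simps)
qed simp

lemma eval_override_cong:
  "(\<And>i. i \<in> vars t \<Longrightarrow> \<rho> i = \<rho>' i) \<Longrightarrow> eval_tree (override \<rho> x) t = eval_tree (override \<rho>' x) t"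
  by (rule eval_tree_cong) (simp add: override_def)

definition settled :: "restriction \<Rightarrow> bool \<Rightarrow> nat tree \<Rightarrow> bool"
  where "settled \<rho> b t \<longleftrightarrow> vars t \<subseteq> dom \<rho> \<and> (\<forall>x. eval_tree (override \<rho> x) t = b)"

definition live_at :: "restriction \<Rightarrow> nat \<Rightarrow> nat tree \<Rightarrow> bool"
  where "live_at \<rho> v t \<longleftrightarrow> vars t - dom \<rho> = {v} \<and> (\<forall>x. eval_tree (override \<rho> x) t = x v)"

definition live :: "restriction \<Rightarrow> nat tree \<Rightarrow> bool"
  where "live \<rho> t \<longleftrightarrow> (\<exists>v. live_at \<rho> v t)"

text \<open>
  Under \<open>\<rho>\<close> the subtree amounts to its root gate applied to infinitely many distinct free variables.
\<close>

definition nearly_live :: "restriction \<Rightarrow> nat tree \<Rightarrow> bool"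
  where "nearly_live \<rho> t \<longleftrightarrow> (\<exists>g c. t = Node g c \<and>
    (\<forall>n. settled \<rho> (neutral g) (c n) \<or> live \<rho> (c n)) \<and> infinite {n. live \<rho> (c n)})"

lemma settled_cong:
  assumes "\<And>i. i \<in> vars t \<Longrightarrow> \<rho> i = \<rho>' i"
  shows "settled \<rho> b t \<longleftrightarrow> settled \<rho>' b t"
proof -
  have "vars t \<subseteq> dom \<rho> \<longleftrightarrow> vars t \<subseteq> dom \<rho>'"
    using assms by (auto simp: dom_def subset_iff)
  then show ?thesis
    using eval_override_cong[OF assms] by (simp add: settled_def)
qed

lemma live_at_cong:
  assumes "\<And>i. i \<in> vars t \<Longrightarrow> \<rho> i = \<rho>' i"
  shows "live_at \<rho> v t \<longleftrightarrow> live_at \<rho>' v t"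
proof -
  have "vars t - dom \<rho> = vars t - dom \<rho>'" using assms by auto
  then show ?thesis
    using eval_override_cong[OF assms] by (simp add: live_at_def)
qed

text \<open>
  Lets the update lemmas below be proved once for \<open>live\<close> and \<open>nearly_live\<close>.
\<close>

definition local_property :: "(restriction \<Rightarrow> nat tree \<Rightarrow> bool) \<Rightarrow> bool"
  where "local_property L \<longleftrightarrow> (\<forall>t \<rho> \<rho>'. (\<forall>i\<in>vars t. \<rho> i = \<rho>' i) \<longrightarrow> L \<rho> t = L \<rho>' t)"

lemma local_property_live: "local_property live"
  unfolding local_property_def live_def using live_at_cong by blast

lemma local_property_nearly_live: "local_property nearly_live"
  unfolding local_property_def
proof (intro allI impI)
  fix t and \<rho> \<rho>' :: restriction
  assume eq: "\<forall>i\<in>vars t. \<rho> i = \<rho>' i"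
  show "nearly_live \<rho> t = nearly_live \<rho>' t"
  proof (cases t)
    case (Node g c)
    have "settled \<rho> b (c n) = settled \<rho>' b (c n)" "live \<rho> (c n) = live \<rho>' (c n)" for b n
      using eq Node settled_cong[of "c n" \<rho> \<rho>' b] local_property_live
      by (auto simp: local_property_def)
    then show ?thesis by (simp add: nearly_live_def Node)
  qed (simp add: nearly_live_def)
qed

lemma settled_mono:
  assumes "settled \<rho> b t" "\<rho> \<subseteq>\<^sub>m \<rho>'"
  shows "settled \<rho>' b t"
proof -
  have "\<rho> i = \<rho>' i" if "i \<in> vars t" for i
    using that assms by (auto simp: settled_def map_le_def)
  then show ?thesis using settled_cong assms(1) by blast
qed

lemma live_at_mono:
  assumes "live_at \<rho> v t" "\<rho> \<subseteq>\<^sub>m \<rho>'" "v \<notin> dom \<rho>'"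
  shows "live_at \<rho>' v t"
proof -
  have "\<rho> i = \<rho>' i" if "i \<in> vars t" for i
  proof (cases "i \<in> dom \<rho>")
    case False
    then have "i = v" using that assms(1) by (auto simp: live_at_def)
    then show ?thesis using False assms(3) by (auto simp: domIff)
  qed (use assms(2) in \<open>auto simp: map_le_def\<close>)
  then show ?thesis using live_at_cong assms(1) by blast
qed

lemma live_at_settled:
  assumes "live_at \<rho> v t" "\<rho> \<subseteq>\<^sub>m \<rho>'" "\<rho>' v = Some b"
  shows "settled \<rho>' b t"
proof -
  have "vars t \<subseteq> dom \<rho>'"
  proof
    fix i assume "i \<in> vars t"
    then have "i = v \<or> i \<in> dom \<rho>" using assms(1) unfolding live_at_def by blast
    then show "i \<in> dom \<rho>'" using assms(3) map_le_implies_dom_le[OF assms(2)] by blast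
  qed
  moreover have "eval_tree (override \<rho>' x) t = b" for x
  proof -
    have "eval_tree (override \<rho>' x) t = eval_tree (override \<rho> (override \<rho>' x)) t"
      by (simp add: override_map_le[OF assms(2)])
    also have "\<dots> = b" using assms(1,3) by (simp add: live_at_def)
    finally show ?thesis .
  qed
  ultimately show ?thesis by (simp add: settled_def)
qed

lemma live_at_unique_free: "live_at \<rho> v t \<Longrightarrow> i \<in> vars t \<Longrightarrow> \<rho> i = None \<Longrightarrow> i = v"
  by (auto simp: live_at_def)

lemma live_at_var: "live_at \<rho> v t \<Longrightarrow> v \<in> vars t" "live_at \<rho> v t \<Longrightarrow> v \<notin> dom \<rho>"
  by (auto simp: live_at_def)

definition fill :: "restriction \<Rightarrow> nat set \<Rightarrow> (nat \<Rightarrow> bool) \<Rightarrow> restriction"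
  where "fill \<rho> A x = (\<lambda>i. if i \<in> A \<and> \<rho> i = None then Some (x i) else \<rho> i)"

lemma map_le_fill: "\<rho> \<subseteq>\<^sub>m fill \<rho> A x"
  by (auto simp: map_le_def fill_def)

lemma fill_outside: "i \<notin> A \<Longrightarrow> fill \<rho> A x i = \<rho> i"
  by (simp add: fill_def)

lemma fill_free: "i \<in> A \<Longrightarrow> \<rho> i = None \<Longrightarrow> fill \<rho> A x i = Some (x i)"
  by (simp add: fill_def)

lemma dom_fill: "dom (fill \<rho> A x) = dom \<rho> \<union> A"
  by (auto simp: fill_def split: if_splits)

lemma override_fill: "override (fill \<rho> A x) x = override \<rho> x"
  by (rule ext) (auto simp: override_def fill_def split: option.splits)

text \<open>
  All free variables of \<open>w\<close> but \<open>v\<close> get the value that the gate of \<open>w\<close> ignores, so \<open>w\<close> reduces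
  to \<open>v\<close>. Fixing \<open>v\<close> at the absorbing value settles \<open>w\<close>, and releasing \<open>v\<close> makes \<open>w\<close> live.
\<close>

lemma nearly_live_keep_one:
  assumes "nearly_live \<rho> w" "inj_labelled w" "w = Node g c"
  obtains \<rho>' v where "\<rho> \<subseteq>\<^sub>m \<rho>'" "\<And>i. i \<notin> vars w \<Longrightarrow> \<rho>' i = \<rho> i" "v \<notin> dom \<rho>" "v \<in> dom \<rho>'"
    "settled \<rho>' (\<not> neutral g) w" "live_at (\<rho>' |` (- {v})) v w"
proof -
  have children: "settled \<rho> (neutral g) (c n) \<or> live \<rho> (c n)" for n
    using assms(1,3) by (auto simp: nearly_live_def)
  have inf: "infinite {n. live \<rho> (c n)}"
    using assms(1,3) by (auto simp: nearly_live_def)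
  obtain m where "live \<rho> (c m)" using inf not_finite_existsD by auto
  then obtain v where v: "live_at \<rho> v (c m)" by (auto simp: live_def)
  have vm: "v \<in> vars (c m)" "v \<notin> dom \<rho>" using live_at_var[OF v] .
  have disj: "n = m" if "v \<in> vars (c n)" for n
    using assms(2,3) that vm(1) by (auto simp: disjoint_family_on_def)
  define \<rho>1 where "\<rho>1 = fill \<rho> (vars w - {v}) (\<lambda>_. neutral g)"
  have le1: "\<rho> \<subseteq>\<^sub>m \<rho>1" unfolding \<rho>1_def by (rule map_le_fill)
  have v1: "\<rho>1 v = None" using vm(2) by (simp add: \<rho>1_def fill_def domIff)
  have other: "settled \<rho>1 (neutral g) (c n)" if "n \<noteq> m" for n
    using children[of n]
  proof
    assume "live \<rho> (c n)"
    then obtain u where u: "live_at \<rho> u (c n)" by (auto simp: live_def)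
    have "u \<in> vars w" using live_at_var(1)[OF u] assms(3) by auto
    moreover have "u \<noteq> v" using live_at_var(1)[OF u] disj that by auto
    ultimately have "\<rho>1 u = Some (neutral g)"
      using live_at_var(2)[OF u] by (auto simp: \<rho>1_def fill_free domIff)
    then show ?thesis by (rule live_at_settled[OF u le1])
  qed (rule settled_mono[OF _ le1])
  have mine: "live_at \<rho>1 v (c m)"
    using live_at_mono[OF v le1] v1 by auto
  have "eval_tree (override \<rho>1 x) w = x v" for x
  proof -
    have "eval_tree (override \<rho>1 x) (c n) = neutral g" if "n \<noteq> m" for n
      using other[OF that] by (simp add: settled_def)
    moreover have "eval_tree (override \<rho>1 x) (c m) = x v"
      using mine by (simp add: live_at_def)
    ultimately have "(\<forall>n. eval_tree (override \<rho>1 x) (c n) = neutral g) \<longleftrightarrow> x v = neutral g"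
      by metis
    then show ?thesis by (auto simp: assms(3) eval_tree_Node simp del: eval_tree.simps)
  qed
  moreover have "vars w - dom \<rho>1 = {v}"
    using vm v1 assms(3) by (auto simp: \<rho>1_def dom_fill)
  ultimately have live1: "live_at \<rho>1 v w" by (simp add: live_at_def)
  define \<rho>' where "\<rho>' = \<rho>1(v \<mapsto> \<not> neutral g)"
  have le2: "\<rho>1 \<subseteq>\<^sub>m \<rho>'" using v1 by (auto simp: \<rho>'_def map_le_def)
  have "\<rho>' |` (- {v}) = \<rho>1"
    using v1 by (auto simp: \<rho>'_def restrict_map_def)
  moreover have "settled \<rho>' (\<not> neutral g) w"
    using live1 le2 by (rule live_at_settled) (simp add: \<rho>'_def)
  moreover have "\<rho>' i = \<rho> i" if "i \<notin> vars w" for i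
    using that vm(1) assms(3) by (auto simp: \<rho>'_def \<rho>1_def fill_def)
  ultimately show thesis
    using that[of \<rho>' v] live1 vm(2) map_le_trans[OF le1 le2] by (simp add: \<rho>'_def)
qed

section \<open>Fusion of restrictions\<close>

text \<open>
  \<open>G i\<close> is the invariant before the decision of stage \<open>i\<close> and \<open>G' i\<close> the one after it; \<open>Fam i\<close> is
  the family of sets decided at that stage; \<open>R i\<close> records which subtree \<open>t i\<close> the stage has
  dealt with. The final \<open>\<rho>\<omega>\<close> is the union of all stages with the variables \<open>v i\<close> released. Subtrees
  in \<open>U\<close> do not overlap, so each \<open>t i\<close> contains no released variable other than its own, and it is
  live in the end. A subtree that is settled at some stage stays settled unless a released variable
  lies below it.
\<close>

lemma fusion:
  fixes G G' :: "nat \<Rightarrow> restriction \<Rightarrow> bool" and R :: "nat \<Rightarrow> nat tree \<Rightarrow> restriction \<Rightarrow> bool"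
  assumes init: "G 0 \<rho>0"
    and disj: "\<And>t t'. t \<in> U \<Longrightarrow> t' \<in> U \<Longrightarrow> vars t \<inter> vars t' \<noteq> {} \<Longrightarrow> t = t'"
    and decide: "\<And>i \<rho> C. G i \<rho> \<Longrightarrow> finite C \<Longrightarrow> \<exists>\<sigma>. \<rho> \<subseteq>\<^sub>m \<sigma> \<and> G' i \<sigma> \<and>
      (\<forall>S\<in>Fam i. \<forall>p. dom p = C \<longrightarrow> clopen_under \<sigma> (override p -` S))"
    and commit: "\<And>i \<sigma>. G' i \<sigma> \<Longrightarrow> \<exists>\<rho>' v t b. \<sigma> \<subseteq>\<^sub>m \<rho>' \<and> G (Suc i) \<rho>' \<and> t \<in> U \<and> v \<notin> dom \<sigma> \<and>
      v \<in> dom \<rho>' \<and> settled \<rho>' b t \<and> live_at (\<rho>' |` (- {v})) v t \<and> R i t \<rho>'"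
  obtains \<rho>\<omega> P t v where "\<rho>0 \<subseteq>\<^sub>m \<rho>\<omega>" "\<And>i S. S \<in> Fam i \<Longrightarrow> clopen_under \<rho>\<omega> S"
    "\<And>i. G i (P i)" "\<And>i. R i (t i) (P (Suc i))" "\<And>i. t i \<in> U" "inj t"
    "\<And>i. live_at \<rho>\<omega> (v i) (t i)"
    "\<And>i b t'. settled (P i) b t' \<Longrightarrow> (\<And>j. v j \<notin> vars t') \<Longrightarrow> settled \<rho>\<omega> b t'"
proof -
  define I :: "nat \<Rightarrow> restriction \<times> nat set \<times> nat \<times> nat tree \<Rightarrow> bool"
    where "I = (\<lambda>n (\<rho>, C, v, t). G n \<rho> \<and> finite C \<and> (n = 0 \<longrightarrow> \<rho> = \<rho>0 \<and> C = {}))"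
  define Q :: "nat \<Rightarrow> restriction \<times> nat set \<times> nat \<times> nat tree \<Rightarrow>
      restriction \<times> nat set \<times> nat \<times> nat tree \<Rightarrow> bool"
    where "Q = (\<lambda>i (\<rho>, C, _, _) (\<rho>', C', v, t). C' = insert v C \<and> (\<exists>\<sigma>. \<rho> \<subseteq>\<^sub>m \<sigma> \<and> \<sigma> \<subseteq>\<^sub>m \<rho>' \<and>
      (\<forall>S\<in>Fam i. \<forall>p. dom p = C \<longrightarrow> clopen_under \<sigma> (override p -` S)) \<and> v \<notin> dom \<sigma> \<and> v \<in> dom \<rho>' \<and>
      t \<in> U \<and> (\<exists>b. settled \<rho>' b t) \<and> live_at (\<rho>' |` (- {v})) v t \<and> R i t \<rho>'))"
  have "\<exists>f. \<forall>n. I n (f n) \<and> Q n (f n) (f (Suc n))"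
  proof (rule dependent_nat_choice)
    have "I 0 (\<rho>0, {}, 0, undefined)" using init by (simp add: I_def)
    then show "\<exists>x. I 0 x" ..
  next
    fix x i assume "I i x"
    moreover obtain \<rho> C v0 t0 where x: "x = (\<rho>, C, v0, t0)" by (metis surj_pair)
    ultimately have G: "G i \<rho>" and C: "finite C" by (simp_all add: I_def)
    obtain \<sigma> where \<sigma>: "\<rho> \<subseteq>\<^sub>m \<sigma>" "G' i \<sigma>"
      "\<forall>S\<in>Fam i. \<forall>p. dom p = C \<longrightarrow> clopen_under \<sigma> (override p -` S)"
      using decide[OF G C] by blast
    obtain \<rho>' v t b where \<rho>': "\<sigma> \<subseteq>\<^sub>m \<rho>'" "G (Suc i) \<rho>'" "t \<in> U" "v \<notin> dom \<sigma>" "v \<in> dom \<rho>'"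
      "settled \<rho>' b t" "live_at (\<rho>' |` (- {v})) v t" "R i t \<rho>'"
      using commit[OF \<sigma>(2)] by blast
    have "I (Suc i) (\<rho>', insert v C, v, t)" using \<rho>'(2) C by (simp add: I_def)
    moreover have "Q i x (\<rho>', insert v C, v, t)"
      unfolding Q_def x prod.case using \<sigma> \<rho>' by blast
    ultimately show "\<exists>y. I (Suc i) y \<and> Q i x y" by blast
  qed
  then obtain f where f: "\<And>n. I n (f n)" "\<And>n. Q n (f n) (f (Suc n))" by blast
  define P where "P = (\<lambda>i. fst (f i))"
  define C where "C = (\<lambda>i. fst (snd (f i)))"
  define v where "v = (\<lambda>i. fst (snd (snd (f (Suc i)))))"
  define t where "t = (\<lambda>i. snd (snd (snd (f (Suc i)))))"
  have GP: "G i (P i)" and finC: "finite (C i)" for i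
    using f(1)[of i] by (simp_all add: I_def P_def C_def split: prod.splits)
  have P0: "P 0 = \<rho>0" and C0: "C 0 = {}"
    using f(1)[of 0] by (simp_all add: I_def P_def C_def split: prod.splits)
  have CSuc: "C (Suc i) = insert (v i) (C i)" for i
    using f(2)[of i] by (simp add: Q_def C_def v_def split: prod.splits)
  have "\<exists>\<sigma>. P i \<subseteq>\<^sub>m \<sigma> \<and> \<sigma> \<subseteq>\<^sub>m P (Suc i) \<and>
      (\<forall>S\<in>Fam i. \<forall>p. dom p = C i \<longrightarrow> clopen_under \<sigma> (override p -` S)) \<and> v i \<notin> dom \<sigma> \<and>
      v i \<in> dom (P (Suc i)) \<and> t i \<in> U \<and> (\<exists>b. settled (P (Suc i)) b (t i)) \<and>
      live_at (P (Suc i) |` (- {v i})) (v i) (t i) \<and> R i (t i) (P (Suc i))" for i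
    using f(2)[of i] by (simp add: Q_def P_def C_def v_def t_def split: prod.splits)
  then obtain \<sigma> where \<sigma>: "\<And>i. P i \<subseteq>\<^sub>m \<sigma> i" "\<And>i. \<sigma> i \<subseteq>\<^sub>m P (Suc i)"
      "\<And>i S p. S \<in> Fam i \<Longrightarrow> dom p = C i \<Longrightarrow> clopen_under (\<sigma> i) (override p -` S)"
      "\<And>i. v i \<notin> dom (\<sigma> i)" "\<And>i. t i \<in> U" "\<And>i. \<exists>b. settled (P (Suc i)) b (t i)"
      "\<And>i. live_at (P (Suc i) |` (- {v i})) (v i) (t i)" "\<And>i. R i (t i) (P (Suc i))"
    by metis
  have PS: "P i \<subseteq>\<^sub>m P (Suc i)" for i using \<sigma>(1,2) by (rule map_le_trans)
  have P_mono: "P i \<subseteq>\<^sub>m P j" if "i \<le> j" for i j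
    using that
  proof (induction rule: dec_induct)
    case (step n)
    then show ?case using PS[of n] by (blast intro: map_le_trans)
  qed simp
  have v_fresh: "v j \<notin> dom (P i)" if "i \<le> j" for i j
    by (rule contra_subsetD[OF map_le_implies_dom_le[OF map_le_trans[OF P_mono[OF that] \<sigma>(1)]] \<sigma>(4)])
  have v_fresh': "v j \<notin> dom (\<sigma> i)" if "i \<le> j" for i j
  proof (cases "i = j")
    case False
    then have "Suc i \<le> j" using that by simp
    then show ?thesis
      by (rule contra_subsetD[OF map_le_implies_dom_le[OF \<sigma>(2)] v_fresh])
  qed (use \<sigma>(4) in simp)
  have C_eq: "C i = v ` {..<i}" for i
    by (induction i) (simp_all add: C0 CSuc lessThan_Suc)
  define \<rho>\<omega> where "\<rho>\<omega> = (\<lambda>k. if k \<notin> range v \<and> (\<exists>i. k \<in> dom (P i))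
    then P (LEAST i. k \<in> dom (P i)) k else None)"
  have \<rho>\<omega>_eq: "\<rho>\<omega> k = P i k" if k: "k \<in> dom (P i)" "k \<notin> range v" for i k
  proof -
    let ?l = "LEAST i. k \<in> dom (P i)"
    have "k \<in> dom (P ?l)" using k(1) by (rule LeastI)
    moreover have "?l \<le> i" using k(1) by (rule Least_le)
    ultimately have "P ?l k = P i k" using P_mono[of ?l i] by (simp add: map_le_def)
    moreover have "\<exists>i. k \<in> dom (P i)" using k(1) ..
    ultimately show ?thesis using k(2) by (simp only: \<rho>\<omega>_def simp_thms if_True)
  qed
  have v_notin: "v i \<notin> dom \<rho>\<omega>" for i by (simp add: \<rho>\<omega>_def domIff)
  have in_vars: "v i \<in> vars (t i)" for i using live_at_var(1)[OF \<sigma>(7)] .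
  have t_inj: "i = j" if "t i = t j" for i j
  proof -
    have "\<not> i < j" if "t i = t j" for i j
    proof
      assume "i < j"
      have "v j \<in> vars (t i)" using in_vars[of j] that by simp
      then have "v j \<in> dom (P (Suc i))" using \<sigma>(6)[of i] by (auto simp: settled_def)
      then show False using v_fresh[of "Suc i" j] \<open>i < j\<close> by simp
    qed
    from this[of i j] this[of j i] that show ?thesis by simp
  qed
  show thesis
  proof
    show "\<rho>0 \<subseteq>\<^sub>m \<rho>\<omega>"
    proof -
      have "k \<notin> range v" if "k \<in> dom \<rho>0" for k
        using v_fresh[of 0] that P0 by auto
      then show ?thesis using \<rho>\<omega>_eq[of _ 0] P0 by (simp add: map_le_def)
    qed
    show "clopen_under \<rho>\<omega> S" if "S \<in> Fam i" for i S
    proof -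
      have "clopen_under (\<sigma> i |` (- C i)) S"
        using finC \<sigma>(3)[OF that] by (rule clopen_under_release)
      moreover have "\<sigma> i |` (- C i) \<subseteq>\<^sub>m \<rho>\<omega>"
        unfolding map_le_def
      proof
        fix k assume "k \<in> dom (\<sigma> i |` (- C i))"
        then have k: "k \<in> dom (\<sigma> i)" "k \<notin> C i" by simp_all
        have "k \<notin> range v"
        proof
          assume "k \<in> range v"
          then obtain j where j: "k = v j" by blast
          then have "i \<le> j" using k(2) by (auto simp: C_eq not_less[symmetric])
          then show False using v_fresh'[of i j] j k(1) by simp
        qed
        moreover have "\<sigma> i k = P (Suc i) k" using \<sigma>(2)[of i] k(1) by (simp add: map_le_def)
        ultimately show "(\<sigma> i |` (- C i)) k = \<rho>\<omega> k"
          using \<rho>\<omega>_eq[of k "Suc i"] k by (simp add: domIff)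
      qed
      ultimately show ?thesis by (rule clopen_under_mono)
    qed
    show "G i (P i)" "R i (t i) (P (Suc i))" "t i \<in> U" for i
      using GP \<sigma>(5,8) by simp_all
    show "inj t" using t_inj by (rule injI)
    show "live_at \<rho>\<omega> (v i) (t i)" for i
    proof -
      have "(P (Suc i) |` (- {v i})) k = \<rho>\<omega> k" if k: "k \<in> vars (t i)" for k
      proof (cases "k = v i")
        case True
        then show ?thesis using v_notin[of i] by (simp add: domIff)
      next
        case False
        have "k \<notin> range v"
        proof
          assume "k \<in> range v"
          then obtain j where "k = v j" by blast
          then have "t i = t j" using k in_vars[of j] disj[OF \<sigma>(5) \<sigma>(5), of i j] by blast
          then show False using t_inj \<open>k = v j\<close> False by blast
        qed
        moreover have "k \<in> dom (P (Suc i))" using k \<sigma>(6)[of i] by (auto simp: settled_def)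
        ultimately show ?thesis using \<rho>\<omega>_eq False by simp
      qed
      then show ?thesis using live_at_cong[of "t i" "P (Suc i) |` (- {v i})" \<rho>\<omega>] \<sigma>(7)[of i] by simp
    qed
    show "settled \<rho>\<omega> b t'" if "settled (P i) b t'" "\<And>j. v j \<notin> vars t'" for i b t'
    proof -
      have "P i k = \<rho>\<omega> k" if k: "k \<in> vars t'" for k
      proof -
        have "k \<in> dom (P i)" using k \<open>settled (P i) b t'\<close> by (auto simp: settled_def)
        moreover have "k \<notin> range v" using k \<open>\<And>j. v j \<notin> vars t'\<close> by auto
        ultimately show ?thesis using \<rho>\<omega>_eq by simp
      qed
      then show ?thesis using settled_cong[of t' "P i" \<rho>\<omega> b] \<open>settled (P i) b t'\<close> by simp
    qed
  qed
qed

text \<open>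
  Bookkeeping for the fusion: every requirement is served infinitely often.
\<close>

lemma repeating_enumeration:
  assumes "countable E" "E \<noteq> {}"
  obtains e :: "nat \<Rightarrow> 'a" where "\<And>i. e i \<in> E" "\<And>x. x \<in> E \<Longrightarrow> infinite {i. e i = x}"
proof
  let ?e = "\<lambda>i. from_nat_into E (fst (prod_decode i))"
  show "?e i \<in> E" for i using assms(2) by (rule from_nat_into)
  show "infinite {i. ?e i = x}" if x: "x \<in> E" for x
  proof -
    obtain k where "from_nat_into E k = x"
      using from_nat_into_surj[OF assms(1) x] by blast
    then have "range (\<lambda>j. prod_encode (k, j)) \<subseteq> {i. ?e i = x}" by auto
    moreover have "infinite (range (\<lambda>j. prod_encode (k, j)))"
      by (rule range_inj_infinite) (simp add: inj_on_def)
    ultimately show ?thesis by (rule infinite_super)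
  qed
qed

section \<open>Pruned trees\<close>

lemma local_propertyD:
  "local_property L \<Longrightarrow> (\<And>i. i \<in> vars t \<Longrightarrow> \<rho> i = \<rho>' i) \<Longrightarrow> L \<rho> t = L \<rho>' t"
  unfolding local_property_def by blast

locale alternating_tree =
  fixes T :: "nat tree"
  assumes full_T: "full (tree_rank T) T" and inj_T: "inj_labelled T" and alt_T: "alternating T"
begin

lemmas cut_unique_T = cut_unique[OF inj_T]

lemma full_vertex: "u \<in> subtrees T \<Longrightarrow> full (tree_rank u) u"
  using full_T by (rule full_subtrees)

lemma inj_vertex: "u \<in> subtrees T \<Longrightarrow> inj_labelled u"
  using inj_T by (rule inj_labelled_subtrees[rotated])

lemma alternating_neutral:
  assumes "Node g c \<in> subtrees T" "c n = Node g' c'"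
  shows "(\<not> neutral g') = neutral g"
proof -
  have "alternating (Node g c)" using assms(1) alt_T by (rule alternating_subtrees)
  then have "g' \<noteq> g" using assms(2) by auto
  then show ?thesis by (cases g; cases g') (simp_all add: neutral_def)
qed

lemma cut_sibling:
  "(g, c, n) \<in> cut T a \<Longrightarrow> tree_rank (c m) \<le> a \<Longrightarrow> (g, c, m) \<in> cut T a"
  by (simp add: in_cut_iff)

definition pruned :: "(restriction \<Rightarrow> nat tree \<Rightarrow> bool) \<Rightarrow> omega1 \<Rightarrow> restriction \<Rightarrow> bool"
  where "pruned L a \<rho> \<longleftrightarrow> (\<forall>g c n. (g, c, n) \<in> cut T a \<longrightarrow>
    (settled \<rho> (neutral g) (c n) \<or> tree_rank (c n) = a \<and> L \<rho> (c n)) \<and>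
    (tree_rank (c n) = a \<longrightarrow> infinite {m. tree_rank (c m) = a \<and> L \<rho> (c m)}))"

lemma prunedD:
  assumes "pruned L a \<rho>" "(g, c, n) \<in> cut T a"
  shows "settled \<rho> (neutral g) (c n) \<or> tree_rank (c n) = a \<and> L \<rho> (c n)"
    and "tree_rank (c n) = a \<Longrightarrow> infinite {m. tree_rank (c m) = a \<and> L \<rho> (c m)}"
  using assms by (simp_all add: pruned_def)

text \<open>
  The subtrees below a cut are disjoint, so a change of the restriction inside one of them can cost
  its parent only that one child.
\<close>

lemma pruned_update:
  assumes p: "pruned L a \<rho>" and L: "local_property L" and e: "(g0, c0, n0) \<in> cut T a"
    and out: "\<And>i. i \<notin> vars (c0 n0) \<Longrightarrow> \<rho>' i = \<rho> i"
    and new: "settled \<rho>' (neutral g0) (c0 n0) \<or> tree_rank (c0 n0) = a \<and> L \<rho>' (c0 n0)"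
  shows "pruned L a \<rho>'"
proof -
  have same: "\<rho> i = \<rho>' i"
    if "(g, c, n) \<in> cut T a" "(g, c, n) \<noteq> (g0, c0, n0)" "i \<in> vars (c n)" for g c n i
  proof (cases "i \<in> vars (c0 n0)")
    case True
    then show ?thesis using cut_unique_T[OF e that(1) True that(3)] that(2) by simp
  qed (simp add: out)
  have L_same: "L \<rho>' (c n) = L \<rho> (c n)"
    if "(g, c, n) \<in> cut T a" "(g, c, n) \<noteq> (g0, c0, n0)" for g c n
    by (rule local_propertyD[OF L]) (rule same[OF that, symmetric])
  show ?thesis
    unfolding pruned_def
  proof (intro allI impI conjI)
    fix g c n assume cut: "(g, c, n) \<in> cut T a"
    show "settled \<rho>' (neutral g) (c n) \<or> tree_rank (c n) = a \<and> L \<rho>' (c n)"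
    proof (cases "(g, c, n) = (g0, c0, n0)")
      case False
      have "settled \<rho>' (neutral g) (c n) = settled \<rho> (neutral g) (c n)"
        by (rule settled_cong) (rule same[OF cut False, symmetric])
      then show ?thesis
        using prunedD(1)[OF p cut] L_same[OF cut False] by simp
    qed (use new in simp)
    assume rank: "tree_rank (c n) = a"
    have "{m. tree_rank (c m) = a \<and> L \<rho> (c m)} - {n0} \<subseteq> {m. tree_rank (c m) = a \<and> L \<rho>' (c m)}"
    proof
      fix m assume m: "m \<in> {m. tree_rank (c m) = a \<and> L \<rho> (c m)} - {n0}"
      have "(g, c, m) \<in> cut T a" by (rule cut_sibling[OF cut]) (use m in simp)
      moreover have "(g, c, m) \<noteq> (g0, c0, n0)" using m by simp
      ultimately have "L \<rho>' (c m) = L \<rho> (c m)" by (rule L_same)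
      then show "m \<in> {m. tree_rank (c m) = a \<and> L \<rho>' (c m)}" using m by simp
    qed
    moreover have "infinite ({m. tree_rank (c m) = a \<and> L \<rho> (c m)} - {n0})"
      using prunedD(2)[OF p cut rank] by simp
    ultimately show "infinite {m. tree_rank (c m) = a \<and> L \<rho>' (c m)}"
      by (rule infinite_super)
  qed
qed

lemma pruned_cong:
  assumes p: "pruned L a \<rho>" and L: "local_property L" and eq: "\<And>i. i \<in> vars T \<Longrightarrow> \<rho> i = \<rho>' i"
  shows "pruned L a \<rho>'"
proof -
  have *: "settled \<rho>' b u = settled \<rho> b u" "L \<rho>' u = L \<rho> u" if "u \<in> subtrees T" for u b
  proof -
    have "\<rho>' i = \<rho> i" if "i \<in> vars u" for i
      using vars_subtrees[OF \<open>u \<in> subtrees T\<close>] eq that by (simp add: subset_iff)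
    note same = this
    show "settled \<rho>' b u = settled \<rho> b u" using same by (rule settled_cong)
    show "L \<rho>' u = L \<rho> u" using same by (rule local_propertyD[OF L])
  qed
  show ?thesis
    unfolding pruned_def
  proof (intro allI impI)
    fix g c n assume cut: "(g, c, n) \<in> cut T a"
    then have "Node g c \<in> subtrees T" by (simp add: in_cut_iff)
    then have "c m \<in> subtrees T" for m by (rule subtrees_child)
    note same = *[OF this]
    show "(settled \<rho>' (neutral g) (c n) \<or> tree_rank (c n) = a \<and> L \<rho>' (c n)) \<and>
      (tree_rank (c n) = a \<longrightarrow> infinite {m. tree_rank (c m) = a \<and> L \<rho>' (c m)})"
      unfolding same using prunedD[OF p cut] by simp
  qed
qed

text \<open>
  The input that gives every variable of the tree the value ignored by the vertex just above the cut.
\<close>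

definition neutral_input :: "omega1 \<Rightarrow> nat \<Rightarrow> bool"
  where "neutral_input a i \<longleftrightarrow> (\<exists>g c n. (g, c, n) \<in> cut T a \<and> i \<in> vars (c n) \<and> neutral g)"

lemma neutral_input_eq:
  "(g, c, n) \<in> cut T a \<Longrightarrow> i \<in> vars (c n) \<Longrightarrow> neutral_input a i = neutral g"
  unfolding neutral_input_def using cut_unique_T(1)[of g c n a] by blast

lemma extend_live:
  assumes "a < tree_rank T" "pruned live a \<rho>" "\<rho> i = None"
  shows "\<exists>\<rho>'. \<rho> \<subseteq>\<^sub>m \<rho>' \<and> i \<in> dom \<rho>' \<and>
    override \<rho>' (neutral_input a) = override \<rho> (neutral_input a) \<and> pruned live a \<rho>'"
proof -
  let ?\<rho>' = "fill \<rho> {i} (neutral_input a)"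
  have "pruned live a ?\<rho>'"
  proof (cases "i \<in> vars T")
    case False
    show ?thesis
    proof (rule pruned_cong[OF assms(2) local_property_live])
      fix j assume "j \<in> vars T"
      then have "j \<notin> {i}" using False by auto
      then show "\<rho> j = ?\<rho>' j" by (simp add: fill_outside)
    qed
  next
    case True
    then obtain g c n where e: "(g, c, n) \<in> cut T a" "i \<in> vars (c n)"
      using cut_cover[OF _ assms(1)] by blast
    then have "\<not> settled \<rho> (neutral g) (c n)" using assms(3) by (auto simp: settled_def)
    then obtain v where v: "live_at \<rho> v (c n)"
      using prunedD(1)[OF assms(2) e(1)] by (auto simp: live_def)
    have "v = i" using live_at_unique_free[OF v e(2) assms(3)] by simp
    then have "settled ?\<rho>' (neutral g) (c n)"
      using live_at_settled[OF v map_le_fill, of "{i}" "neutral_input a" "neutral g"] assms(3)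
        neutral_input_eq[OF e] by (simp add: fill_free)
    moreover have "?\<rho>' j = \<rho> j" if "j \<notin> vars (c n)" for j
      using that e(2) by (intro fill_outside) auto
    ultimately show ?thesis
      using pruned_update[OF assms(2) local_property_live e(1)] by blast
  qed
  then show ?thesis
    by (intro exI[of _ ?\<rho>']) (simp add: map_le_fill override_fill dom_fill)
qed

text \<open>
  A free variable \<open>i\<close> is a live child of a nearly live vertex. If \<open>x i\<close> is neutral there, the
  vertex loses one of infinitely many children. Otherwise the vertex takes the absorbing value, which
  by alternation its parent ignores, and the rest of its variables can be fixed as in \<open>x\<close>.
\<close>

lemma extend_nearly_live:
  assumes "a < tree_rank T" "pruned nearly_live a \<rho>" "\<rho> i = None"
  shows "\<exists>\<rho>'. \<rho> \<subseteq>\<^sub>m \<rho>' \<and> i \<in> dom \<rho>' \<and> override \<rho>' x = override \<rho> x \<and> pruned nearly_live a \<rho>'"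
proof (cases "i \<in> vars T")
  case False
  have "pruned nearly_live a (fill \<rho> {i} x)"
  proof (rule pruned_cong[OF assms(2) local_property_nearly_live])
    fix j assume "j \<in> vars T"
    then have "j \<notin> {i}" using False by auto
    then show "\<rho> j = fill \<rho> {i} x j" by (simp add: fill_outside)
  qed
  then show ?thesis
    by (intro exI[of _ "fill \<rho> {i} x"]) (simp add: map_le_fill override_fill dom_fill)
next
  case True
  then obtain g c n where e: "(g, c, n) \<in> cut T a" "i \<in> vars (c n)"
    using cut_cover[OF _ assms(1)] by blast
  then have "\<not> settled \<rho> (neutral g) (c n)" using assms(3) by (auto simp: settled_def)
  then have rank: "tree_rank (c n) = a" and nl: "nearly_live \<rho> (c n)"
    using prunedD(1)[OF assms(2) e(1)] by auto
  obtain g' c' where w: "c n = Node g' c'"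
    and children: "\<And>m. settled \<rho> (neutral g') (c' m) \<or> live \<rho> (c' m)"
    and inf: "infinite {m. live \<rho> (c' m)}"
    using nl by (auto simp: nearly_live_def)
  have vertex: "Node g c \<in> subtrees T" using e(1) by (simp add: in_cut_iff)
  have neutral: "(\<not> neutral g') = neutral g" using alternating_neutral[OF vertex w] .
  obtain m where m: "i \<in> vars (c' m)" using e(2) w by auto
  then have "\<not> settled \<rho> (neutral g') (c' m)" using assms(3) by (auto simp: settled_def)
  then obtain v where v: "live_at \<rho> v (c' m)" using children[of m] by (auto simp: live_def)
  have vi: "v = i" using live_at_unique_free[OF v m assms(3)] by simp
  define A where "A = (if x i = neutral g' then {i} else vars (c n))"
  let ?\<rho>' = "fill \<rho> A x"
  have iA: "i \<in> A" and A: "A \<subseteq> vars (c n)" using e(2) by (simp_all add: A_def)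
  have child: "settled ?\<rho>' (x i) (c' m)"
    using live_at_settled[OF v map_le_fill, of A x "x i"] vi iA assms(3) by (simp add: fill_free)
  have "settled ?\<rho>' (neutral g) (c n) \<or> tree_rank (c n) = a \<and> nearly_live ?\<rho>' (c n)"
  proof (cases "x i = neutral g'")
    case True
    have inj: "inj_labelled (c n)" using inj_vertex[OF subtrees_child[OF vertex]] .
    have same: "?\<rho>' j = \<rho> j" if "k \<noteq> m" "j \<in> vars (c' k)" for k j
    proof -
      have "j \<noteq> i" using inj w that m by (auto simp: disjoint_family_on_def)
      then show ?thesis using True by (simp add: A_def fill_outside)
    qed
    have others: "settled ?\<rho>' b (c' k) = settled \<rho> b (c' k)" "live ?\<rho>' (c' k) = live \<rho> (c' k)"
      if "k \<noteq> m" for k b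
      by (rule settled_cong[OF same[OF that]], assumption)
        (rule local_propertyD[OF local_property_live same[OF that]], assumption)
    have "settled ?\<rho>' (neutral g') (c' k) \<or> live ?\<rho>' (c' k)" for k
      using others[of k] children[of k] child True by (cases "k = m") auto
    moreover have "infinite {k. live ?\<rho>' (c' k)}"
    proof (rule infinite_super)
      show "{k. live \<rho> (c' k)} - {m} \<subseteq> {k. live ?\<rho>' (c' k)}" using others(2) by auto
      show "infinite ({k. live \<rho> (c' k)} - {m})" using inf by simp
    qed
    ultimately have "nearly_live ?\<rho>' (c n)" unfolding nearly_live_def using w by blast
    then show ?thesis using rank by blast
  next
    case False
    have "vars (c n) \<subseteq> dom ?\<rho>'" using False by (auto simp: dom_fill A_def)
    moreover have "eval_tree (override ?\<rho>' y) (c n) = neutral g" for y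
    proof -
      have "eval_tree (override ?\<rho>' y) (c' m) \<noteq> neutral g'"
        using child False by (simp add: settled_def)
      then show ?thesis using neutral by (auto simp: w eval_tree_Node simp del: eval_tree.simps)
    qed
    ultimately show ?thesis by (simp add: settled_def)
  qed
  then have "pruned nearly_live a ?\<rho>'"
    using A by (intro pruned_update[OF assms(2) local_property_nearly_live e(1)])
      (auto intro: fill_outside)
  then show ?thesis
    using iA by (intro exI[of _ ?\<rho>']) (simp add: map_le_fill override_fill dom_fill)
qed

section \<open>Collapsing the vertices of one rank\<close>

text \<open>
  An open set that is not already empty under the restriction becomes everything after finitely
  many variables have been fixed; in either case it is clopen.
\<close>

lemma decide_open:
  assumes "a < tree_rank T" "pruned nearly_live a \<rho>" "finite \<Y>" "\<And>S. S \<in> \<Y> \<Longrightarrow> open_under \<rho> S"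
  shows "\<exists>\<sigma>. \<rho> \<subseteq>\<^sub>m \<sigma> \<and> pruned nearly_live a \<sigma> \<and> (\<forall>S\<in>\<Y>. clopen_under \<sigma> S)"
  using assms(3,4)
proof (induction \<Y>)
  case empty
  then show ?case using assms(2) by (intro exI[of _ \<rho>]) simp
next
  case (insert S \<Y>)
  then obtain \<sigma> where \<sigma>: "\<rho> \<subseteq>\<^sub>m \<sigma>" "pruned nearly_live a \<sigma>" "\<forall>S\<in>\<Y>. clopen_under \<sigma> S" by auto
  have S: "open_under \<sigma> S" using insert.prems[of S] \<sigma>(1) by (auto intro: open_under_mono)
  have "\<exists>\<sigma>'. \<sigma> \<subseteq>\<^sub>m \<sigma>' \<and> pruned nearly_live a \<sigma>' \<and> clopen_under \<sigma>' S"
  proof (cases "\<exists>x. override \<sigma> x \<in> S")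
    case True
    then obtain x where x: "override \<sigma> x \<in> S" ..
    obtain \<sigma>' where \<sigma>': "\<sigma> \<subseteq>\<^sub>m \<sigma>'" "pruned nearly_live a \<sigma>'" "\<forall>y. override \<sigma>' y \<in> S"
      using extend_towards[where Q = "pruned nearly_live a", OF extend_nearly_live[OF assms(1)] \<sigma>(2) S x]
      by blast
    then have "override \<sigma>' -` S = UNIV" "override \<sigma>' -` (- S) = {}" by auto
    then have "clopen_under \<sigma>' S" by (simp add: clopen_under_def open_under_def)
    then show ?thesis using \<sigma>' by blast
  next
    case False
    then have "override \<sigma> -` S = {}" "override \<sigma> -` (- S) = UNIV" by auto
    then have "clopen_under \<sigma> S" by (simp add: clopen_under_def open_under_def)
    then show ?thesis using \<sigma>(2) by (intro exI[of _ \<sigma>]) simp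
  qed
  then obtain \<sigma>' where \<sigma>': "\<sigma> \<subseteq>\<^sub>m \<sigma>'" "pruned nearly_live a \<sigma>'" "clopen_under \<sigma>' S" by blast
  have "\<forall>S'\<in>insert S \<Y>. clopen_under \<sigma>' S'"
    using \<sigma>(3) \<sigma>'(1,3) clopen_under_mono by blast
  then show ?case using \<sigma>' map_le_trans[OF \<sigma>(1) \<sigma>'(1)] by blast
qed

text \<open>
  Fusion over the vertices of rank \<open>a\<close> just below the cut. Each such edge is processed infinitely
  often. When it is processed, its lower vertex, or some sibling if that one is already settled, is
  reduced to a single variable that is set aside. So no vertex stays undecided, and every parent
  ends up with infinitely many live children although the decisions may kill others in between.
\<close>

lemma collapse:
  assumes a: "a < tree_rank T" and near: "pruned nearly_live a \<rho>0" and count: "countable \<D>"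
    and op: "\<And>S p. S \<in> \<D> \<Longrightarrow> finite (dom p) \<Longrightarrow> open_under \<rho>0 (override p -` S)"
  obtains \<rho> where "\<rho>0 \<subseteq>\<^sub>m \<rho>" "pruned live a \<rho>" "\<And>S. S \<in> \<D> \<Longrightarrow> clopen_under \<rho> S"
proof -
  define E where "E = {e \<in> cut T a. case e of (g, c, n) \<Rightarrow> tree_rank (c n) = a}"
  have "countable E"
    unfolding E_def by (rule countable_subset[OF _ countable_cut[of T a]]) blast
  moreover have "E \<noteq> {}" using full_cut_exists[OF full_T a] by (auto simp: E_def)
  ultimately obtain e where e: "\<And>i. e i \<in> E" "\<And>x. x \<in> E \<Longrightarrow> infinite {i :: nat. e i = x}"
    using repeating_enumeration by blast
  \<comment> \<open>The empty set is added because \<open>from_nat_into\<close> enumerates nonempty sets only.\<close>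
  define s where "s = from_nat_into (insert {} \<D>)"
  have s_in: "s i \<in> insert {} \<D>" for i unfolding s_def by (rule from_nat_into) simp
  have s_open: "open_under \<rho>0 (override p -` s i)" if "finite (dom p)" for i p
    using s_in[of i] op[OF _ that] by (auto simp: open_under_def)
  define R :: "nat \<Rightarrow> nat tree \<Rightarrow> restriction \<Rightarrow> bool" where "R = (\<lambda>i t \<rho>. case e i of (g, c, n) \<Rightarrow>
    (\<exists>m. t = c m \<and> tree_rank (c m) = a) \<and> settled \<rho> (neutral g) (c n))"
  define U where "U = {c n | g c n. (g, c, n) \<in> cut T a}"
  define G :: "nat \<Rightarrow> restriction \<Rightarrow> bool"
    where "G = (\<lambda>i \<rho>. \<rho>0 \<subseteq>\<^sub>m \<rho> \<and> pruned nearly_live a \<rho>)"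
  have disj: "t = t'" if t: "t \<in> U" "t' \<in> U" "vars t \<inter> vars t' \<noteq> {}" for t t'
  proof -
    obtain g c n g' c' n' where
      *: "(g, c, n) \<in> cut T a" "t = c n" "(g', c', n') \<in> cut T a" "t' = c' n'"
      using t(1,2) by (auto simp: U_def)
    obtain v where "v \<in> vars t" "v \<in> vars t'" using t(3) by blast
    then show ?thesis using cut_unique_T[OF *(1,3), of v] *(2,4) by simp
  qed
  obtain \<rho>\<omega> P t v where \<omega>: "\<rho>0 \<subseteq>\<^sub>m \<rho>\<omega>" "\<And>i S. S \<in> {s i} \<Longrightarrow> clopen_under \<rho>\<omega> S"
    "\<And>i. G i (P i)" "\<And>i. R i (t i) (P (Suc i))" "\<And>i. t i \<in> U" "inj t"
    "\<And>i. live_at \<rho>\<omega> (v i) (t i)"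
    "\<And>i b t'. settled (P i) b t' \<Longrightarrow> (\<And>j. v j \<notin> vars t') \<Longrightarrow> settled \<rho>\<omega> b t'"
  proof (rule fusion[where G = G and G' = G and R = R and U = U and Fam = "\<lambda>i. {s i}" and ?\<rho>0.0 = \<rho>0])
    show "G 0 \<rho>0" using near by (simp add: G_def)
    show "t = t'" if "t \<in> U" "t' \<in> U" "vars t \<inter> vars t' \<noteq> {}" for t t'
      using that by (rule disj)
    show "\<exists>\<sigma>. \<rho> \<subseteq>\<^sub>m \<sigma> \<and> G i \<sigma> \<and> (\<forall>S\<in>{s i}. \<forall>p. dom p = C \<longrightarrow> clopen_under \<sigma> (override p -` S))"
      if G: "G i \<rho>" and C: "finite C" for i \<rho> C
    proof -
      let ?\<Y> = "(\<lambda>p. override p -` s i) ` {p. dom p = C}"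
      have "\<exists>\<sigma>. \<rho> \<subseteq>\<^sub>m \<sigma> \<and> pruned nearly_live a \<sigma> \<and> (\<forall>S\<in>?\<Y>. clopen_under \<sigma> S)"
      proof (rule decide_open[OF a])
        show "pruned nearly_live a \<rho>" using G by (simp add: G_def)
        show "finite ?\<Y>" using finite_maps_on[OF C] by (rule finite_imageI)
        fix S assume "S \<in> ?\<Y>"
        then obtain p where "dom p = C" "S = override p -` s i" by blast
        then show "open_under \<rho> S"
          using open_under_mono[OF s_open[of p i]] C G by (simp add: G_def)
      qed
      then obtain \<sigma> where \<sigma>: "\<rho> \<subseteq>\<^sub>m \<sigma>" "pruned nearly_live a \<sigma>" "\<forall>S\<in>?\<Y>. clopen_under \<sigma> S" by blast
      have "G i \<sigma>" using G \<sigma>(1,2) map_le_trans by (auto simp: G_def)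
      then show ?thesis using \<sigma>(1,3) by (intro exI[of _ \<sigma>]) simp
    qed
    show "\<exists>\<rho>' v t b. \<sigma> \<subseteq>\<^sub>m \<rho>' \<and> G (Suc i) \<rho>' \<and> t \<in> U \<and> v \<notin> dom \<sigma> \<and> v \<in> dom \<rho>' \<and>
        settled \<rho>' b t \<and> live_at (\<rho>' |` (- {v})) v t \<and> R i t \<rho>'" if G: "G i \<sigma>" for i \<sigma>
    proof -
      obtain g c n where ei: "e i = (g, c, n)" by (metis surj_pair)
      have cut: "(g, c, n) \<in> cut T a" and rank: "tree_rank (c n) = a"
        using e(1)[of i] ei by (simp_all add: E_def)
      have pr: "pruned nearly_live a \<sigma>" using G by (simp add: G_def)
      have "\<exists>m. tree_rank (c m) = a \<and> nearly_live \<sigma> (c m) \<and> (m = n \<or> settled \<sigma> (neutral g) (c n))"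
      proof (cases "settled \<sigma> (neutral g) (c n)")
        case True
        obtain m where "tree_rank (c m) = a \<and> nearly_live \<sigma> (c m)"
          using not_finite_existsD[OF prunedD(2)[OF pr cut rank]] by blast
        then show ?thesis using True by blast
      next
        case False
        then show ?thesis using prunedD(1)[OF pr cut] by blast
      qed
      then obtain m where m: "tree_rank (c m) = a" "nearly_live \<sigma> (c m)"
        "m = n \<or> settled \<sigma> (neutral g) (c n)" by blast
      have cut_m: "(g, c, m) \<in> cut T a" using cut m(1) by (intro cut_sibling[OF cut]) simp
      have vertex: "Node g c \<in> subtrees T" using cut by (simp add: in_cut_iff)
      obtain g' c' where w: "c m = Node g' c'" using m(2) by (auto simp: nearly_live_def)
      have inj: "inj_labelled (c m)" using inj_vertex[OF subtrees_child[OF vertex]] .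
      obtain \<rho>' v where \<rho>': "\<sigma> \<subseteq>\<^sub>m \<rho>'" "\<And>i. i \<notin> vars (c m) \<Longrightarrow> \<rho>' i = \<sigma> i" "v \<notin> dom \<sigma>" "v \<in> dom \<rho>'"
        "settled \<rho>' (\<not> neutral g') (c m)" "live_at (\<rho>' |` (- {v})) v (c m)"
        using nearly_live_keep_one[OF m(2) inj w] by blast
      have st: "settled \<rho>' (neutral g) (c m)"
        using \<rho>'(5) alternating_neutral[OF vertex w] by simp
      have "pruned nearly_live a \<rho>'"
        using pruned_update[OF pr local_property_nearly_live cut_m \<rho>'(2)] st by blast
      then have "G (Suc i) \<rho>'"
        using G map_le_trans[OF _ \<rho>'(1)] by (auto simp: G_def)
      moreover have "c m \<in> U" using cut_m by (auto simp: U_def)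
      moreover have "settled \<rho>' (neutral g) (c n)"
        using m(3) st settled_mono[OF _ \<rho>'(1)] by auto
      then have "R i (c m) \<rho>'" using m(1) by (auto simp: R_def ei)
      ultimately show ?thesis using \<rho>'(1,3,4,6) st by blast
    qed
  qed (use that in blast)
  \<comment> \<open>If a released variable lies below \<open>u\<close>, then \<open>u\<close> is the subtree from which it was set aside.\<close>
  have live_if: "live \<rho>\<omega> u" if "u \<in> U" "v j \<in> vars u" for j u
  proof -
    have "t j = u"
      using disj[OF \<omega>(5) that(1), of j] that(2) live_at_var(1)[OF \<omega>(7)[of j]] by blast
    then show ?thesis using \<omega>(7)[of j] by (auto simp: live_def)
  qed
  have "pruned live a \<rho>\<omega>"
    unfolding pruned_def
  proof (intro allI impI conjI)
    fix g c n assume cut: "(g, c, n) \<in> cut T a"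
    have inU: "c n \<in> U" using cut by (auto simp: U_def)
    show "settled \<rho>\<omega> (neutral g) (c n) \<or> tree_rank (c n) = a \<and> live \<rho>\<omega> (c n)"
    proof (cases "tree_rank (c n) = a")
      case True
      then have "(g, c, n) \<in> E" using cut by (simp add: E_def)
      then obtain i where ei: "e i = (g, c, n)" using not_finite_existsD[OF e(2)] by blast
      have "settled (P (Suc i)) (neutral g) (c n)" using \<omega>(4)[of i] by (simp add: R_def ei)
      then show ?thesis using \<omega>(8) live_if[OF inU] True by blast
    next
      case False
      then have "settled \<rho>0 (neutral g) (c n)" using prunedD(1)[OF near cut] by blast
      then show ?thesis using settled_mono[OF _ \<omega>(1)] by blast
    qed
    assume "tree_rank (c n) = a"
    then have "(g, c, n) \<in> E" using cut by (simp add: E_def)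
    then have "infinite (t ` {i. e i = (g, c, n)})"
      using e(2) \<omega>(6) by (metis finite_imageD inj_on_subset subset_UNIV)
    moreover have "t ` {i. e i = (g, c, n)} \<subseteq> c ` {m. tree_rank (c m) = a \<and> live \<rho>\<omega> (c m)}"
    proof
      fix u assume "u \<in> t ` {i. e i = (g, c, n)}"
      then obtain i where i: "e i = (g, c, n)" "u = t i" by blast
      obtain m where "t i = c m" "tree_rank (c m) = a" using \<omega>(4)[of i] by (auto simp: R_def i(1))
      moreover have "live \<rho>\<omega> (t i)" using \<omega>(7)[of i] by (auto simp: live_def)
      ultimately show "u \<in> c ` {m. tree_rank (c m) = a \<and> live \<rho>\<omega> (c m)}" using i(2) by auto
    qed
    ultimately show "infinite {m. tree_rank (c m) = a \<and> live \<rho>\<omega> (c m)}"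
      by (meson finite_imageI finite_subset)
  qed
  moreover have "clopen_under \<rho>\<omega> S" if S: "S \<in> \<D>" for S
  proof -
    obtain i where "s i = S"
      using from_nat_into_surj[of "insert {} \<D>" S] count S by (auto simp: s_def)
    then show ?thesis using \<omega>(2)[of S i] by simp
  qed
  ultimately show thesis using that \<omega>(1) by blast
qed

section \<open>Induction on the level\<close>

text \<open>
  A vertex of rank \<open>a + 1\<close> has only children of rank \<open>a\<close>, and by assumption it is already a gate over
  live variables. The vertices of rank \<open>a\<close> that hang from a vertex of rank above \<open>a + 1\<close> are
  too low for the new cut and must be settled; \<open>A\<close> consists of the variables below them.
\<close>

lemma nearly_live_succ:
  assumes "pruned live a \<rho>"
  shows "\<exists>\<rho>'. \<rho> \<subseteq>\<^sub>m \<rho>' \<and> pruned nearly_live (a + 1) \<rho>'"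
proof -
  define A where
    "A = {i. \<exists>g c n. (g, c, n) \<in> cut T a \<and> a + 1 < tree_rank (Node g c) \<and> i \<in> vars (c n)}"
  let ?\<rho>' = "fill \<rho> A (neutral_input a)"
  have le: "\<rho> \<subseteq>\<^sub>m ?\<rho>'" by (rule map_le_fill)
  have killed: "settled ?\<rho>' (neutral g) (c n)"
    if cut: "(g, c, n) \<in> cut T a" and high: "a + 1 < tree_rank (Node g c)" for g c n
    using prunedD(1)[OF assms cut]
  proof
    assume "tree_rank (c n) = a \<and> live \<rho> (c n)"
    then obtain v where v: "live_at \<rho> v (c n)" by (auto simp: live_def)
    have "v \<in> A" unfolding A_def using cut high live_at_var(1)[OF v] by blast
    then have "?\<rho>' v = Some (neutral g)"
      using live_at_var[OF v] neutral_input_eq[OF cut] by (simp add: fill_free domIff)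
    then show ?thesis by (rule live_at_settled[OF v le])
  qed (rule settled_mono[OF _ le])
  have same: "?\<rho>' i = \<rho> i"
    if cut: "(g, c, n) \<in> cut T a" and low: "tree_rank (Node g c) = a + 1" and i: "i \<in> vars (c n)"
    for g c n i
  proof -
    have "i \<notin> A"
    proof
      assume "i \<in> A"
      then obtain g' c' n' where *: "(g', c', n') \<in> cut T a" "a + 1 < tree_rank (Node g' c')"
        "i \<in> vars (c' n')" by (auto simp: A_def)
      then show False using cut_unique_T(1,2)[OF cut *(1) i *(3)] low by simp
    qed
    then show ?thesis by (rule fill_outside)
  qed
  have near: "nearly_live ?\<rho>' w" if w: "w \<in> subtrees T" "tree_rank w = a + 1" for w
  proof (cases w)
    case (Leaf i)
    then show ?thesis using w(2) less_succ_omega1_iff[of a a] zero_le_omega1[of a] by simp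
  next
    case (Node g c)
    have full_w: "full (a + 1) (Node g c)" using full_vertex[OF w(1)] w(2) Node by simp
    have rank: "tree_rank (c m) = a" for m
    proof (rule full_Node_cases[OF full_w])
      fix b assume "a + 1 = b + 1" "\<And>n. full b (c n)"
      then show ?thesis using tree_rank_full[of a "c m"] by simp
    qed simp
    have cut: "(g, c, m) \<in> cut T a" for m
      using w Node rank by (simp add: in_cut_iff less_succ_omega1_iff)
    have same_child: "?\<rho>' i = \<rho> i" if "i \<in> vars (c m)" for i m
      using same[OF cut _ that] w(2) Node by simp
    have "settled ?\<rho>' (neutral g) (c m) = settled \<rho> (neutral g) (c m)" for m
      by (rule settled_cong) (rule same_child)
    moreover have live_same: "live ?\<rho>' (c m) = live \<rho> (c m)" for m
      by (rule local_propertyD[OF local_property_live]) (rule same_child)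
    ultimately have "settled ?\<rho>' (neutral g) (c m) \<or> live ?\<rho>' (c m)" for m
      using prunedD(1)[OF assms cut[of m]] by blast
    moreover have "infinite {m. live ?\<rho>' (c m)}"
      using prunedD(2)[OF assms cut[of 0] rank] rank by (simp add: live_same)
    ultimately show ?thesis unfolding nearly_live_def Node by blast
  qed
  have "pruned nearly_live (a + 1) ?\<rho>'"
    unfolding pruned_def
  proof (intro allI impI conjI)
    fix g c n assume cut: "(g, c, n) \<in> cut T (a + 1)"
    then have vertex: "Node g c \<in> subtrees T" and high: "a + 1 < tree_rank (Node g c)"
      and low: "tree_rank (c n) \<le> a + 1" by (simp_all add: in_cut_iff)
    have near_child: "nearly_live ?\<rho>' (c m)" if "tree_rank (c m) = a + 1" for m
      using near[OF subtrees_child[OF vertex] that] .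
    show "settled ?\<rho>' (neutral g) (c n) \<or> tree_rank (c n) = a + 1 \<and> nearly_live ?\<rho>' (c n)"
    proof (cases "tree_rank (c n) = a + 1")
      case False
      then have "tree_rank (c n) < a + 1" using low by simp
      then have "tree_rank (c n) \<le> a" by (simp only: less_succ_omega1_iff)
      moreover have "a < tree_rank (Node g c)"
        by (rule succ_le_omega1_iff[THEN iffD1, OF order_less_imp_le[OF high]])
      ultimately show ?thesis using killed[OF _ high] vertex by (simp add: in_cut_iff)
    qed (use near_child in blast)
    assume rank: "tree_rank (c n) = a + 1"
    have "{m. tree_rank (c m) = a + 1} = {m. tree_rank (c m) = a + 1 \<and> nearly_live ?\<rho>' (c m)}"
      using near_child by blast
    then show "infinite {m. tree_rank (c m) = a + 1 \<and> nearly_live ?\<rho>' (c m)}"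
      using full_infinite_siblings[OF full_vertex[OF vertex], of n] rank by simp
  qed
  then show ?thesis using le by blast
qed

lemma limit_vertex:
  assumes "u \<in> subtrees T" "limit_omega1 (tree_rank u)"
  shows "\<exists>g c. u = Node g c \<and> (\<forall>d<tree_rank u. infinite {n. tree_rank (c n) = d})"
proof (cases u)
  case (Leaf i)
  then show ?thesis using assms(2) by (simp add: limit_omega1_def)
next
  case (Node g c)
  have full_u: "full (tree_rank u) (Node g c)" using full_vertex[OF assms(1)] Node by simp
  show ?thesis
  proof (rule full_Node_cases[OF full_u])
    fix b assume "tree_rank u = b + 1"
    then show ?thesis using assms(2) by simp
  next
    assume "\<And>d. d < tree_rank u \<Longrightarrow> infinite {n. tree_rank (c n) = d}"
    then show ?thesis using Node by blast
  qed
qed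

definition resolved :: "(omega1 \<times> (nat \<Rightarrow> bool) set) set \<Rightarrow> omega1 \<Rightarrow> restriction \<Rightarrow> bool"
  where "resolved \<S> a \<rho> \<longleftrightarrow> pruned live a \<rho> \<and> (\<forall>b S. (b, S) \<in> \<S> \<longrightarrow> b \<le> a \<longrightarrow> clopen_under \<rho> S)"

text \<open>
  Fusion along a sequence \<open>d\<close> cofinal in \<open>a\<close>. Deciding means passing from \<open>d i\<close> to \<open>d (i + 1)\<close> by
  the assumption \<open>step\<close>, which may settle all vertices of rank below \<open>d (i + 1)\<close>. The later
  stages will settle those of rank \<open>d (i + 1)\<close> as well, so one live child of this rank is rescued below
  some vertex of rank \<open>a\<close>, by setting its variable aside. Each vertex of rank \<open>a\<close> is served infinitely often, so it ends up as a gate over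
  infinitely many free variables; every other child falls below some \<open>d i\<close> and is settled.
\<close>

lemma nearly_live_limit:
  assumes stable: "stable_family \<S>" and lim: "limit_omega1 a" and aT: "a < tree_rank T"
    and d: "\<And>i. d i \<le> d (Suc i)" "\<And>i. d i < a" "\<And>b. b < a \<Longrightarrow> \<exists>i. b < d i"
    and start: "resolved \<S> (d 0) \<rho>0"
    and step: "\<And>i \<rho>. resolved \<S> (d i) \<rho> \<Longrightarrow> \<exists>\<sigma>. \<rho> \<subseteq>\<^sub>m \<sigma> \<and> resolved \<S> (d (Suc i)) \<sigma>"
  shows "\<exists>\<rho>. \<rho>0 \<subseteq>\<^sub>m \<rho> \<and> pruned nearly_live a \<rho> \<and>
    (\<forall>b S. (b, S) \<in> \<S> \<longrightarrow> b < a \<longrightarrow> clopen_under \<rho> S)"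
proof -
  define E where "E = {u \<in> subtrees T. tree_rank u = a}"
  have "countable E"
    unfolding E_def by (rule countable_subset[OF _ countable_subtrees[of T]]) blast
  moreover have "E \<noteq> {}"
  proof -
    obtain g c n where "(g, c, n) \<in> cut T a" "tree_rank (c n) = a"
      using full_cut_exists[OF full_T aT] by blast
    then have "c n \<in> E" using subtrees_child[of g c T n] by (simp add: E_def in_cut_iff)
    then show ?thesis by blast
  qed
  ultimately obtain e where e: "\<And>i. e i \<in> E" "\<And>x. x \<in> E \<Longrightarrow> infinite {i :: nat. e i = x}"
    using repeating_enumeration by blast
  define U where "U = {c m | g c m. Node g c \<in> E}"
  define R :: "nat \<Rightarrow> nat tree \<Rightarrow> restriction \<Rightarrow> bool"
    where "R = (\<lambda>i t \<rho>. \<exists>g c m. e i = Node g c \<and> t = c m)"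
  define Fam where "Fam = (\<lambda>i. {S. \<exists>b\<le>d (Suc i). (b, S) \<in> \<S>})"
  have E_unique: "u = u'" if u: "u \<in> E" "u' \<in> E" "v \<in> vars u" "v \<in> vars u'" for u u' v
  proof -
    obtain g c n where 1: "(g, c, n) \<in> cut T a" "c n = u"
      using cut_of_vertex[of u T] u(1) aT by (auto simp: E_def)
    obtain g' c' n' where 2: "(g', c', n') \<in> cut T a" "c' n' = u'"
      using cut_of_vertex[of u' T] u(2) aT by (auto simp: E_def)
    show ?thesis using cut_unique_T[OF 1(1) 2(1), of v] u(3,4) 1(2) 2(2) by simp
  qed
  have child_unique: "c m = c' m' \<and> Node g c = Node g' c'"
    if *: "Node g c \<in> E" "Node g' c' \<in> E" "v \<in> vars (c m)" "v \<in> vars (c' m')" for g c m g' c' m' v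
  proof -
    have "v \<in> vars (Node g c)" "v \<in> vars (Node g' c')" using *(3,4) by auto
    then have eq: "Node g c = Node g' c'" using E_unique *(1,2) by blast
    have "inj_labelled (Node g c)" using inj_vertex[of "Node g c"] *(1) by (simp add: E_def del: inj_labelled.simps)
    then have "m = m'" using *(3,4) eq by (auto simp: disjoint_family_on_def)
    then show ?thesis using eq by simp
  qed
  have disj: "t = t'" if t: "t \<in> U" "t' \<in> U" "vars t \<inter> vars t' \<noteq> {}" for t t'
  proof -
    obtain g c m g' c' m' where "Node g c \<in> E" "t = c m" "Node g' c' \<in> E" "t' = c' m'"
      using t(1,2) by (auto simp: U_def)
    moreover obtain v where "v \<in> vars t" "v \<in> vars t'" using t(3) by blast
    ultimately show ?thesis using child_unique by blast
  qed
  obtain \<rho>\<omega> P t v where \<omega>: "\<rho>0 \<subseteq>\<^sub>m \<rho>\<omega>" "\<And>i S. S \<in> Fam i \<Longrightarrow> clopen_under \<rho>\<omega> S"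
    "\<And>i. resolved \<S> (d i) (P i)" "\<And>i. R i (t i) (P (Suc i))" "\<And>i. t i \<in> U" "inj t"
    "\<And>i. live_at \<rho>\<omega> (v i) (t i)"
    "\<And>i b t'. settled (P i) b t' \<Longrightarrow> (\<And>j. v j \<notin> vars t') \<Longrightarrow> settled \<rho>\<omega> b t'"
  proof (rule fusion[where G = "\<lambda>i. resolved \<S> (d i)" and G' = "\<lambda>i. resolved \<S> (d (Suc i))"
        and R = R and U = U and Fam = Fam and ?\<rho>0.0 = \<rho>0])
    show "resolved \<S> (d 0) \<rho>0" by (rule start)
    show "t = t'" if "t \<in> U" "t' \<in> U" "vars t \<inter> vars t' \<noteq> {}" for t t'
      using that by (rule disj)
    show "\<exists>\<sigma>. \<rho> \<subseteq>\<^sub>m \<sigma> \<and> resolved \<S> (d (Suc i)) \<sigma> \<and>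
        (\<forall>S\<in>Fam i. \<forall>p. dom p = C \<longrightarrow> clopen_under \<sigma> (override p -` S))"
      if G: "resolved \<S> (d i) \<rho>" and C: "finite C" for i \<rho> C
    proof -
      obtain \<sigma> where \<sigma>: "\<rho> \<subseteq>\<^sub>m \<sigma>" "resolved \<S> (d (Suc i)) \<sigma>" using step[OF G] by blast
      have "clopen_under \<sigma> (override p -` S)" if S: "S \<in> Fam i" and p: "dom p = C" for S p
      proof -
        obtain b where b: "b \<le> d (Suc i)" "(b, S) \<in> \<S>" using S by (auto simp: Fam_def)
        then have "(b, override p -` S) \<in> \<S>"
          using stable p C by (simp add: stable_family_def)
        then show ?thesis using \<sigma>(2) b(1) by (simp add: resolved_def)
      qed
      then show ?thesis using \<sigma> by blast
    qed
    show "\<exists>\<rho>' v t b. \<sigma> \<subseteq>\<^sub>m \<rho>' \<and> resolved \<S> (d (Suc i)) \<rho>' \<and> t \<in> U \<and> v \<notin> dom \<sigma> \<and> v \<in> dom \<rho>' \<and>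
        settled \<rho>' b t \<and> live_at (\<rho>' |` (- {v})) v t \<and> R i t \<rho>'"
      if G: "resolved \<S> (d (Suc i)) \<sigma>" for i \<sigma>
    proof -
      let ?d = "d (Suc i)"
      have ei: "e i \<in> subtrees T" "tree_rank (e i) = a" using e(1)[of i] by (simp_all add: E_def)
      obtain g c where u: "e i = Node g c" and inf: "\<And>b. b < a \<Longrightarrow> infinite {n. tree_rank (c n) = b}"
        using limit_vertex[OF ei(1)] lim ei(2) by auto
      have pr: "pruned live ?d \<sigma>" using G by (simp add: resolved_def)
      obtain n where n: "tree_rank (c n) = ?d"
        using not_finite_existsD[OF inf[OF d(2)[of "Suc i"]]] by blast
      have cut: "(g, c, n) \<in> cut T ?d" using ei u n d(2)[of "Suc i"] by (simp add: in_cut_iff)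
      obtain m where m: "tree_rank (c m) = ?d" "live \<sigma> (c m)"
        using not_finite_existsD[OF prunedD(2)[OF pr cut n]] by blast
      have cut_m: "(g, c, m) \<in> cut T ?d" using m(1) by (intro cut_sibling[OF cut]) simp
      obtain v where v: "live_at \<sigma> v (c m)" using m(2) by (auto simp: live_def)
      define \<rho>' where "\<rho>' = fill \<sigma> {v} (\<lambda>_. neutral g)"
      have v_free: "\<sigma> v = None" using live_at_var(2)[OF v] by (simp add: domIff)
      have le: "\<sigma> \<subseteq>\<^sub>m \<rho>'" unfolding \<rho>'_def by (rule map_le_fill)
      have st: "settled \<rho>' (neutral g) (c m)"
        using v le by (rule live_at_settled) (simp add: \<rho>'_def fill_free v_free)
      have unfixed: "\<rho>' |` (- {v}) = \<sigma>"
        using v_free by (auto simp: \<rho>'_def fill_def restrict_map_def)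
      have out: "\<rho>' i = \<sigma> i" if "i \<notin> vars (c m)" for i
        using that live_at_var(1)[OF v] by (auto simp: \<rho>'_def fill_def)
      have "pruned live ?d \<rho>'"
        using pruned_update[OF pr local_property_live cut_m out] st by blast
      then have "resolved \<S> ?d \<rho>'"
        using G clopen_under_mono[OF _ le] by (simp add: resolved_def)
      moreover have "c m \<in> U" using e(1)[of i] u by (auto simp: U_def)
      moreover have "R i (c m) \<rho>'" using u by (auto simp: R_def)
      moreover have "v \<in> dom \<rho>'" by (simp add: \<rho>'_def dom_fill)
      ultimately show ?thesis
        using le live_at_var(2)[OF v] st unfixed v by (intro exI[of _ \<rho>'] exI[of _ v] exI[of _ "c m"]) auto
    qed
  qed (use that in blast)
  have committed: "\<exists>g c m. Node g c \<in> E \<and> t j = c m \<and> e j = Node g c" for j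
    using \<omega>(4)[of j] e(1)[of j] by (auto simp: R_def)
  have v_in: "v j \<in> vars (t j)" for j using live_at_var(1)[OF \<omega>(7)] .
  \<comment> \<open>A child is live if a variable below it was set aside, and settled as soon as \<open>d i\<close> exceeds its rank.\<close>
  have near: "nearly_live \<rho>\<omega> w" if w: "w \<in> E" for w
  proof -
    have w': "w \<in> subtrees T" "tree_rank w = a" using w by (simp_all add: E_def)
    obtain g c where u: "w = Node g c" using limit_vertex[OF w'(1)] lim w'(2) by auto
    have "settled \<rho>\<omega> (neutral g) (c m) \<or> live \<rho>\<omega> (c m)" for m
    proof (cases "\<exists>j. v j \<in> vars (c m)")
      case True
      then obtain j where j: "v j \<in> vars (c m)" ..
      obtain g' c' m' where c': "Node g' c' \<in> E" "t j = c' m'" using committed by blast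
      have "v j \<in> vars (c' m')" using v_in[of j] c'(2) by simp
      then have "t j = c m" using child_unique[of g c g' c' "v j" m m'] w u j c' by metis
      then show ?thesis using \<omega>(7)[of j] by (auto simp: live_def)
    next
      case False
      have "tree_rank (c m) < a" using tree_rank_child[of c m g] w'(2) u by simp
      then obtain i where i: "tree_rank (c m) < d i" using d(3) by blast
      have "(g, c, m) \<in> cut T (d i)"
        using w' u i d(2)[of i] by (simp add: in_cut_iff)
      then have "settled (P i) (neutral g) (c m)"
        using prunedD(1)[of live "d i" "P i" g c m] \<omega>(3)[of i] i by (auto simp: resolved_def)
      then show ?thesis using \<omega>(8) False by blast
    qed
    moreover have "infinite {m. live \<rho>\<omega> (c m)}"
    proof -
      have "infinite (t ` {i. e i = w})"
        using e(2)[OF w] \<omega>(6) by (metis finite_imageD inj_on_subset subset_UNIV)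
      moreover have "t ` {i. e i = w} \<subseteq> c ` {m. live \<rho>\<omega> (c m)}"
      proof
        fix x assume "x \<in> t ` {i. e i = w}"
        then obtain i where i: "e i = w" "x = t i" by blast
        obtain m where "t i = c m" using committed[of i] i(1) u by auto
        moreover have "live \<rho>\<omega> (t i)" using \<omega>(7)[of i] by (auto simp: live_def)
        ultimately show "x \<in> c ` {m. live \<rho>\<omega> (c m)}" using i(2) by auto
      qed
      ultimately show ?thesis by (meson finite_imageI finite_subset)
    qed
    ultimately show ?thesis unfolding nearly_live_def u by blast
  qed
  have "pruned nearly_live a \<rho>\<omega>"
    unfolding pruned_def
  proof (intro allI impI conjI)
    fix g c n assume cut: "(g, c, n) \<in> cut T a"
    then have vertex: "Node g c \<in> subtrees T" and high: "a < tree_rank (Node g c)"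
      and low: "tree_rank (c n) \<le> a" by (simp_all add: in_cut_iff)
    have near_child: "nearly_live \<rho>\<omega> (c m)" if "tree_rank (c m) = a" for m
      using near[of "c m"] subtrees_child[OF vertex] that by (simp add: E_def)
    show "settled \<rho>\<omega> (neutral g) (c n) \<or> tree_rank (c n) = a \<and> nearly_live \<rho>\<omega> (c n)"
    proof (cases "tree_rank (c n) = a")
      case False
      then have "tree_rank (c n) < a" using low by simp
      then obtain i where i: "tree_rank (c n) < d i" using d(3) by blast
      have "(g, c, n) \<in> cut T (d i)"
        using vertex i order.strict_trans[OF d(2) high, of i] by (simp add: in_cut_iff)
      then have "settled (P i) (neutral g) (c n)"
        using prunedD(1)[of live "d i" "P i" g c n] \<omega>(3)[of i] i by (auto simp: resolved_def)
      moreover have "v j \<notin> vars (c n)" for j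
      proof
        assume vj: "v j \<in> vars (c n)"
        obtain g' c' m' where w: "Node g' c' \<in> E" "t j = c' m'" using committed by blast
        then have "v j \<in> vars (Node g' c')" using v_in[of j] by auto
        moreover obtain g2 c2 n2 where "(g2, c2, n2) \<in> cut T a" "c2 n2 = Node g' c'"
          using cut_of_vertex[of "Node g' c'" T] w(1) aT by (auto simp: E_def)
        ultimately have "c n = Node g' c'" using cut_unique_T[OF cut, of g2 c2 n2 "v j"] vj by simp
        then show False using w(1) False by (simp add: E_def)
      qed
      ultimately show ?thesis using \<omega>(8) by blast
    qed (use near_child in blast)
    assume rank: "tree_rank (c n) = a"
    have "{m. tree_rank (c m) = a} = {m. tree_rank (c m) = a \<and> nearly_live \<rho>\<omega> (c m)}"
      using near_child by blast
    then show "infinite {m. tree_rank (c m) = a \<and> nearly_live \<rho>\<omega> (c m)}"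
      using full_infinite_siblings[OF full_vertex[OF vertex], of n] rank by simp
  qed
  moreover have "clopen_under \<rho>\<omega> S" if S: "(b, S) \<in> \<S>" "b < a" for b S
  proof -
    obtain i where "b < d i" using d(3)[OF S(2)] by blast
    then have "b \<le> d (Suc i)" using d(1)[of i] by (meson order_less_imp_le order_less_le_trans)
    then have "S \<in> Fam i" using S(1) by (auto simp: Fam_def)
    then show ?thesis by (rule \<omega>(2))
  qed
  ultimately show ?thesis using \<omega>(1) by blast
qed

text \<open>
  Each set of level at most \<open>a\<close>, and each of its finite modifications, is built from sets of level
  below \<open>a\<close>, so it is open and \<open>collapse\<close> applies.
\<close>

lemma resolve_from_nearly_live:
  assumes stable: "stable_family \<S>" and aT: "a < tree_rank T" and near: "pruned nearly_live a \<rho>"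
    and below: "\<And>b S. (b, S) \<in> \<S> \<Longrightarrow> b < a \<Longrightarrow> clopen_under \<rho> S"
  shows "\<exists>\<rho>'. \<rho> \<subseteq>\<^sub>m \<rho>' \<and> resolved \<S> a \<rho>'"
proof -
  define \<D> where "\<D> = {S. \<exists>b\<le>a. (b, S) \<in> \<S>}"
  have "\<D> \<subseteq> snd ` \<S>" by (force simp: \<D>_def)
  then have "countable \<D>"
    using stable by (metis countable_image countable_subset stable_family_def)
  moreover have "open_under \<rho> (override p -` S)" if S: "S \<in> \<D>" and p: "finite (dom p)" for S p
  proof -
    obtain b where b: "b \<le> a" "(b, S) \<in> \<S>" using S by (auto simp: \<D>_def)
    then have "(b, override p -` S) \<in> \<S>" using stable p by (simp add: stable_family_def)
    moreover have "clopen_under \<rho> B" if "b' < b" "(b', B) \<in> \<S>" for b' B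
      using below[OF that(2)] that(1) b(1) by (meson order_less_le_trans)
    moreover have "borel_family \<S>" using stable by (simp add: stable_family_def)
    ultimately show ?thesis using borel_family_open_under by blast
  qed
  ultimately obtain \<rho>' where "\<rho> \<subseteq>\<^sub>m \<rho>'" "pruned live a \<rho>'" "\<And>S. S \<in> \<D> \<Longrightarrow> clopen_under \<rho>' S"
    using collapse[OF aT near] by blast
  then show ?thesis unfolding resolved_def \<D>_def by blast
qed

text \<open>
  The start \<open>c\<close> is arbitrary because the limit case applies the induction hypothesis between
  consecutive members of a cofinal sequence.
\<close>

lemma resolve:
  assumes stable: "stable_family \<S>"
  shows "c \<le> a \<Longrightarrow> a < tree_rank T \<Longrightarrow> resolved \<S> c \<rho> \<Longrightarrow> \<exists>\<rho>'. \<rho> \<subseteq>\<^sub>m \<rho>' \<and> resolved \<S> a \<rho>'"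
proof (induction a arbitrary: c \<rho> rule: less_induct)
  case (less a)
  show ?case
  proof (cases "c = a")
    case True
    then show ?thesis using less.prems(3) by (intro exI[of _ \<rho>]) simp
  next
    case False
    then have ca: "c < a" using less.prems(1) by simp
    have "\<exists>\<rho>1. \<rho> \<subseteq>\<^sub>m \<rho>1 \<and> pruned nearly_live a \<rho>1 \<and>
      (\<forall>b S. (b, S) \<in> \<S> \<longrightarrow> b < a \<longrightarrow> clopen_under \<rho>1 S)"
    proof (cases "\<exists>a'. a = a' + 1")
      case True
      then obtain a' where a': "a = a' + 1" ..
      have "a' < a" by (simp add: a' less_succ_omega1_iff)
      moreover have "c \<le> a'" using ca by (simp add: a' less_succ_omega1_iff)
      ultimately obtain \<sigma> where \<sigma>: "\<rho> \<subseteq>\<^sub>m \<sigma>" "resolved \<S> a' \<sigma>"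
        using less.IH[of a' c \<rho>] order.strict_trans[OF _ less.prems(2), of a'] less.prems(3) by blast
      then obtain \<rho>1 where \<rho>1: "\<sigma> \<subseteq>\<^sub>m \<rho>1" "pruned nearly_live a \<rho>1"
        using nearly_live_succ[of a' \<sigma>] by (auto simp: resolved_def a')
      have "clopen_under \<rho>1 S" if "(b, S) \<in> \<S>" "b < a" for b S
        using \<sigma>(2) that clopen_under_mono[OF _ \<rho>1(1)]
        by (simp add: resolved_def a' less_succ_omega1_iff)
      then show ?thesis using map_le_trans[OF \<sigma>(1) \<rho>1(1)] \<rho>1(2) by blast
    next
      case False
      have "a \<noteq> 0" using ca zero_le_omega1[of c] by auto
      then have lim: "limit_omega1 a" using False by (auto simp: limit_omega1_def)
      obtain d where d: "d 0 = c" "\<And>i. d i \<le> d (Suc i)" "\<And>i. d i < a" "\<And>b. b < a \<Longrightarrow> \<exists>i. b < d i"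
        using limit_cofinal_sequence[OF lim ca] by blast
      show ?thesis
      proof (rule nearly_live_limit[OF stable lim less.prems(2), of d])
        show "\<exists>\<sigma>. \<rho> \<subseteq>\<^sub>m \<sigma> \<and> resolved \<S> (d (Suc i)) \<sigma>" if "resolved \<S> (d i) \<rho>" for i \<rho>
          using less.IH[OF d(3) d(2) _ that] d(3)[of "Suc i"] less.prems(2) by auto
      qed (use d less.prems(3) in auto)
    qed
    then obtain \<rho>1 where \<rho>1: "\<rho> \<subseteq>\<^sub>m \<rho>1" "pruned nearly_live a \<rho>1"
      "\<And>b S. (b, S) \<in> \<S> \<Longrightarrow> b < a \<Longrightarrow> clopen_under \<rho>1 S" by blast
    then obtain \<rho>' where "\<rho>1 \<subseteq>\<^sub>m \<rho>'" "resolved \<S> a \<rho>'"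
      using resolve_from_nearly_live[OF stable less.prems(2) \<rho>1(2)] by blast
    then show ?thesis using map_le_trans[OF \<rho>1(1)] by blast
  qed
qed

lemma resolved_start:
  assumes "stable_family \<S>"
  shows "resolved \<S> 0 Map.empty"
proof -
  have leaf: "live Map.empty w" if w: "w \<in> subtrees T" "tree_rank w \<le> 0" for w
  proof (cases w)
    case (Leaf i)
    then have "live_at Map.empty i w" by (simp add: live_at_def)
    then show ?thesis by (auto simp: live_def)
  next
    case (Node g c)
    then show ?thesis
      using w(2) tree_rank_child[of c 0 g] zero_le_omega1[of "tree_rank (c 0)"] by simp
  qed
  have "pruned live 0 Map.empty"
    unfolding pruned_def
  proof (intro allI impI conjI)
    fix g c n assume cut: "(g, c, n) \<in> cut T 0"
    then have vertex: "Node g c \<in> subtrees T" and low: "tree_rank (c n) \<le> 0"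
      by (simp_all add: in_cut_iff)
    have live_child: "live Map.empty (c m)" if "tree_rank (c m) = 0" for m
      using leaf[OF subtrees_child[OF vertex]] that by simp
    have rank: "tree_rank (c n) = 0" using low zero_le_omega1[of "tree_rank (c n)"] by simp
    then show "settled Map.empty (neutral g) (c n) \<or> tree_rank (c n) = 0 \<and> live Map.empty (c n)"
      using live_child by blast
    have "{m. tree_rank (c m) = 0} = {m. tree_rank (c m) = 0 \<and> live Map.empty (c m)}"
      using live_child by blast
    then show "infinite {m. tree_rank (c m) = 0 \<and> live Map.empty (c m)}"
      using full_infinite_siblings[OF full_vertex[OF vertex], of n] rank by simp
  qed
  moreover have "clopen_under Map.empty S" if S: "(b, S) \<in> \<S>" "b \<le> 0" for b S
  proof -
    have "\<not> b' < b" for b'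
      using S(2) zero_le_omega1[of b'] by (meson leD order_less_le_trans)
    moreover have "built_from \<S> b S"
      using assms S(1) by (simp add: stable_family_def borel_family_def)
    ultimately have "open S" "closed S" unfolding built_from_def by blast+
    moreover have "override Map.empty -` A = A" for A by auto
    ultimately show ?thesis
      by (simp only: clopen_under_def open_under_def) (simp add: open_Compl)
  qed
  ultimately show ?thesis by (simp add: resolved_def)
qed

section \<open>The residual tree\<close>

text \<open>
  The vertices of rank \<open>a + b\<close> become vertices of rank \<open>b\<close>. A vertex keeps the children in \<open>J\<close>,
  those above the cut and the live ones just below it; the others are settled at the neutral
  value. The last conjunct carries alternation through the recursion.
\<close>

lemma residual_tree:
  assumes pr: "pruned live a \<rho>"
  shows "u \<in> subtrees T \<Longrightarrow> tree_rank u = a + b \<Longrightarrow> 0 < b \<Longrightarrow>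
    \<exists>t. full b t \<and> inj_labelled t \<and> alternating t \<and> vars t \<subseteq> vars u - dom \<rho> \<and>
      (\<forall>x. eval_tree (override \<rho> x) u = eval_tree x t) \<and> (\<forall>g c. t = Node g c \<longrightarrow> (\<exists>d. u = Node g d))"
proof (induction b arbitrary: u rule: less_induct)
  case (less b)
  have high: "a < tree_rank u"
    using add_strict_mono_omega1[OF less.prems(3), of a] less.prems(2) by (simp add: add_zero_omega1)
  obtain g c where u: "u = Node g c"
    using high zero_le_omega1[of a] by (cases u) auto
  have vertex: "Node g c \<in> subtrees T" using less.prems(1) u by simp
  have full_u: "full (a + b) (Node g c)" using full_vertex[OF vertex] less.prems(2) u by simp
  define J where "J = {n. a < tree_rank (c n) \<or> tree_rank (c n) = a \<and> live \<rho> (c n)}"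
  define residual where "residual n b' t \<longleftrightarrow> tree_rank (c n) = a + b' \<and> full b' t \<and> inj_labelled t \<and>
      alternating t \<and> vars t \<subseteq> vars (c n) - dom \<rho> \<and>
      (\<forall>x. eval_tree (override \<rho> x) (c n) = eval_tree x t) \<and>
      (\<forall>g c'. t = Node g c' \<longrightarrow> (\<exists>d. c n = Node g d))" for n b' t
  have "\<exists>b' t. residual n b' t" if nJ: "n \<in> J" for n
  proof (cases "a < tree_rank (c n)")
    case True
    then obtain b' where b': "tree_rank (c n) = a + b'"
      using le_omega1_obtains_diff[OF order_less_imp_le[OF True]] by blast
    have "0 < b'" using True b' add_less_cancel_omega1[of a 0 b'] by (simp add: add_zero_omega1)
    moreover have "b' < b" using tree_rank_child[of c n g] b' less.prems(2) u by simp
    ultimately show ?thesis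
      using less.IH[OF _ subtrees_child[OF vertex] b'] b' unfolding residual_def by blast
  next
    case False
    then obtain v where v: "live_at \<rho> v (c n)" and rank: "tree_rank (c n) = a"
      using nJ by (auto simp: J_def live_def)
    have "tree_rank (c n) = a + 0" using rank by (simp add: add_zero_omega1)
    moreover have "full 0 (Leaf v)" by (rule full_zero)
    moreover have "vars (Leaf v) \<subseteq> vars (c n) - dom \<rho>" using live_at_var[OF v] by simp
    moreover have "\<forall>x. eval_tree (override \<rho> x) (c n) = eval_tree x (Leaf v)"
      using v by (simp add: live_at_def)
    ultimately have "residual n 0 (Leaf v)" by (simp add: residual_def)
    then show ?thesis by blast
  qed
  then obtain r t where rt: "\<And>n. n \<in> J \<Longrightarrow> residual n (r n) (t n)" by metis
  have r: "tree_rank (c n) = a + r n" if "n \<in> J" for n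
    using rt[OF that] by (simp add: residual_def)
  have t: "full (r n) (t n)" "inj_labelled (t n)" "alternating (t n)"
    "vars (t n) \<subseteq> vars (c n) - dom \<rho>" "eval_tree (override \<rho> x) (c n) = eval_tree x (t n)"
    "t n = Node h c' \<Longrightarrow> \<exists>d. c n = Node h d" if "n \<in> J" for n x h c'
    using rt[OF that] by (simp_all add: residual_def)
  have cut: "(g, c, n) \<in> cut T a" if "tree_rank (c n) \<le> a" for n
    using that vertex high u by (simp add: in_cut_iff)
  have dead: "settled \<rho> (neutral g) (c n)" if "n \<notin> J" for n
  proof -
    have "tree_rank (c n) \<le> a" using that by (auto simp: J_def)
    then show ?thesis using prunedD(1)[OF pr cut] that by (auto simp: J_def)
  qed
  have inf_live: "infinite {m. tree_rank (c m) = a \<and> live \<rho> (c m)}" if "tree_rank (c n) = a" for n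
    using prunedD(2)[OF pr cut, of n] that by simp
  have r_unique: "r n = d" if "n \<in> J" "tree_rank (c n) = a + d" for n d
    using r[OF that(1)] that(2) by simp
  have "infinite J \<and> (\<forall>e. bij_betw e UNIV J \<longrightarrow> full b (Node g (\<lambda>k. t (e k))))"
  proof (rule full_Node_cases[OF full_u])
    fix b' assume b': "a + b = b' + 1" and children: "\<And>n. full b' (c n)"
    have rank: "tree_rank (c n) = b'" for n using children by (rule tree_rank_full)
    have "a \<le> b'" using high less.prems(2) b' u by (simp add: less_succ_omega1_iff)
    then obtain d where d: "b' = a + d" by (rule le_omega1_obtains_diff)
    have b: "b = d + 1" using b' d by (simp add: add_succ_omega1[symmetric])
    have "infinite J"
    proof (cases "b' = a")
      case True
      have "{m. tree_rank (c m) = a \<and> live \<rho> (c m)} \<subseteq> J" by (auto simp: J_def)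
      then show ?thesis using inf_live[of 0] rank True infinite_super by blast
    next
      case False
      then have "J = UNIV" using \<open>a \<le> b'\<close> by (auto simp: J_def rank)
      then show ?thesis by simp
    qed
    moreover have "full b (Node g (\<lambda>k. t (e k)))" if "bij_betw e UNIV J" for e
      unfolding b
    proof (rule full_succ)
      fix k
      have "e k \<in> J" using that by (auto simp: bij_betw_def)
      then show "full d (t (e k))" using t(1)[of "e k"] r_unique[of "e k" d] rank d by simp
    qed
    ultimately show ?thesis by blast
  next
    assume lim: "limit_omega1 (a + b)"
      and children: "\<And>d. d < a + b \<Longrightarrow> infinite {n. tree_rank (c n) = d}"
    have limb: "limit_omega1 b"
      using less.prems(3) lim by (auto simp: limit_omega1_def add_succ_omega1)
    have many: "infinite {n \<in> J. r n = d}" if "d < b" for d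
    proof (cases "d = 0")
      case True
      obtain n where "tree_rank (c n) = a"
        using not_finite_existsD[OF children[of a]] high less.prems(2) by auto
      then have "infinite {m. tree_rank (c m) = a \<and> live \<rho> (c m)}" by (rule inf_live)
      moreover have "{m. tree_rank (c m) = a \<and> live \<rho> (c m)} \<subseteq> {n \<in> J. r n = d}"
        using r_unique[of _ 0] True by (auto simp: J_def add_zero_omega1)
      ultimately show ?thesis by (rule infinite_super[rotated])
    next
      case False
      then have "0 < d" using zero_le_omega1[of d] by simp
      then have "a < a + d" using add_strict_mono_omega1[of 0 d a] by (simp add: add_zero_omega1)
      then have "{n. tree_rank (c n) = a + d} \<subseteq> {n \<in> J. r n = d}"
        using r_unique[of _ d] by (auto simp: J_def)
      moreover have "infinite {n. tree_rank (c n) = a + d}" using children that by simp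
      ultimately show ?thesis by (rule infinite_super)
    qed
    have "infinite J" using infinite_super[OF _ many[OF less.prems(3)], of J] by blast
    moreover have "full b (Node g (\<lambda>k. t (e k)))" if e: "bij_betw e UNIV J" for e
    proof (rule full_limit[OF limb, where b = "\<lambda>k. r (e k)"])
      have eJ: "e k \<in> J" for k using e by (auto simp: bij_betw_def)
      show "r (e k) < b \<and> full (r (e k)) (t (e k))" for k
        using t(1)[OF eJ] r[OF eJ, of k] tree_rank_child[of c "e k" g] less.prems(2) u by simp
      show "infinite {k. r (e k) = d}" if "d < b" for d
      proof
        assume "finite {k. r (e k) = d}"
        then have "finite (e ` {k. r (e k) = d})" by (rule finite_imageI)
        moreover have "e ` {k. r (e k) = d} = {n \<in> J. r n = d}"
          using e by (auto simp: bij_betw_def)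
        ultimately show False using many[OF that] by simp
      qed
    qed
    ultimately show ?thesis by blast
  qed
  then have infJ: "infinite J" and full_Node: "\<And>e. bij_betw e UNIV J \<Longrightarrow> full b (Node g (\<lambda>k. t (e k)))"
    by blast+
  define e where "e = enumerate J"
  have bij: "bij_betw e UNIV J" unfolding e_def using infJ by (rule bij_enumerate)
  then have eJ: "e k \<in> J" for k by (auto simp: bij_betw_def)
  have e_inj: "e k = e l \<Longrightarrow> k = l" for k l using bij by (auto simp: bij_betw_def inj_def)
  let ?t = "Node g (\<lambda>k. t (e k))"
  have inj_u: "disjoint_family (\<lambda>n. vars (c n))" using inj_vertex[OF vertex] by simp
  have "disjoint_family (\<lambda>k. vars (t (e k)))"
    unfolding disjoint_family_on_def
  proof (intro ballI impI)
    fix k l :: nat assume "k \<noteq> l"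
    then have "e k \<noteq> e l" using e_inj by blast
    then have "vars (c (e k)) \<inter> vars (c (e l)) = {}"
      using inj_u by (simp add: disjoint_family_on_def)
    then show "vars (t (e k)) \<inter> vars (t (e l)) = {}"
      using t(4)[OF eJ[of k]] t(4)[OF eJ[of l]] by blast
  qed
  then have "inj_labelled ?t" using t(2)[OF eJ] by simp
  moreover have "alternating ?t"
  proof -
    have "alternating (Node g c)" using vertex alt_T by (rule alternating_subtrees)
    then have "t (e k) \<noteq> Node g c'" for k c' using t(6)[OF eJ, of k g c'] by auto
    then show ?thesis using t(3)[OF eJ] by simp
  qed
  moreover have "vars ?t \<subseteq> vars u - dom \<rho>"
    using t(4)[OF eJ] u by (simp add: UN_subset_iff subset_iff) blast
  moreover have "eval_tree (override \<rho> x) u = eval_tree x ?t" for x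
  proof -
    have "(\<forall>n. eval_tree (override \<rho> x) (c n) = neutral g) \<longleftrightarrow>
      (\<forall>n\<in>J. eval_tree (override \<rho> x) (c n) = neutral g)"
      using dead by (auto simp: settled_def)
    also have "\<dots> \<longleftrightarrow> (\<forall>n\<in>J. eval_tree x (t n) = neutral g)" using t(5) by simp
    also have "\<dots> \<longleftrightarrow> (\<forall>k. eval_tree x (t (e k)) = neutral g)"
      using bij by (auto simp: bij_betw_def)
    finally show ?thesis by (simp add: u eval_tree_Node del: eval_tree.simps)
  qed
  ultimately show ?case using full_Node[OF bij] u by (intro exI[of _ ?t]) simp
qed

end

theorem corollary1p2:
  fixes \<alpha> \<beta> :: omega1 and f g :: "(nat \<Rightarrow> bool) \<Rightarrow> bool"
  assumes "1 \<le> \<beta>"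
    and "Sigma0_measurable (\<alpha> + 1) f"
    and "tree_function UNIV (\<alpha> + \<beta>) g"
  shows "\<exists>\<rho> :: restriction.
    restricted f \<rho> constant_on cube (free_vars \<rho>) \<and>
    tree_function (free_vars \<rho>) \<beta> (restricted g \<rho>)"
proof -
  have pos: "0 < \<beta>"
    using assms(1) less_one_omega1_iff[of 0] by (metis order_less_le_trans)
  obtain T where T: "full (\<alpha> + \<beta>) T" "inj_labelled T" "alternating T" "\<And>x. g x = eval_tree x T"
    using assms(3) by (auto simp: tree_function_def cube_UNIV)
  have rank: "tree_rank T = \<alpha> + \<beta>" using T(1) by (rule tree_rank_full)
  interpret alternating_tree T
    by standard (use T(1-3) rank in simp_all)
  have aT: "\<alpha> < tree_rank T"
    using add_strict_mono_omega1[OF pos, of \<alpha>] rank by (simp add: add_zero_omega1)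
  have preimage: "Sigma0 (\<alpha> + 1) (f -` {b})" for b
    using assms(2) by (simp add: Sigma0_measurable_def)
  obtain F where F: "\<And>b. countable (F b)" "\<And>b. borel_family (F b)" "\<And>b. (\<alpha> + 1, f -` {b}) \<in> F b"
    using Sigma0_borel_family(1)[OF preimage] by metis
  have "countable (\<Union>(range F))" "borel_family (\<Union>(range F))"
    using F(1,2) by (auto intro!: borel_family_Union)
  then obtain \<S> where \<S>: "stable_family \<S>" "\<Union>(range F) \<subseteq> \<S>" using stable_family_exists by blast
  obtain \<rho> where \<rho>: "resolved \<S> \<alpha> \<rho>"
    using resolve[OF \<S>(1) zero_le_omega1 aT resolved_start[OF \<S>(1)]] by blast
  have f_open: "open_under \<rho> (f -` {b})" for b
  proof (rule borel_family_open_under)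
    show "borel_family \<S>" using \<S>(1) by (simp add: stable_family_def)
    show "(\<alpha> + 1, f -` {b}) \<in> \<S>" using F(3)[of b] \<S>(2) by blast
    show "clopen_under \<rho> B" if "b' < \<alpha> + 1" "(b', B) \<in> \<S>" for b' B
      using \<rho> that by (simp add: resolved_def less_succ_omega1_iff)
  qed
  \<comment> \<open>Fixing variables at their values in this input leaves the tree pruned.\<close>
  let ?x = "neutral_input \<alpha>"
  have "\<exists>\<rho>'. \<rho> \<subseteq>\<^sub>m \<rho>' \<and> pruned live \<alpha> \<rho>' \<and> (\<forall>y. override \<rho>' y \<in> f -` {f (override \<rho> ?x)})"
  proof (rule extend_towards[where Q = "pruned live \<alpha>"])
    show "pruned live \<alpha> \<rho>" using \<rho> by (simp add: resolved_def)
    show "override \<rho> ?x \<in> f -` {f (override \<rho> ?x)}" by simp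
  qed (use extend_live[OF aT] f_open in blast)+
  then obtain \<rho>' where \<rho>': "pruned live \<alpha> \<rho>'" "\<And>y. f (override \<rho>' y) = f (override \<rho> ?x)"
    by auto
  obtain t where t: "full \<beta> t" "inj_labelled t" "alternating t" "vars t \<subseteq> vars T - dom \<rho>'"
    "\<And>x. eval_tree (override \<rho>' x) T = eval_tree x t"
    using residual_tree[OF \<rho>'(1) self_in_subtrees rank pos] by blast
  have "restricted f \<rho>' constant_on cube (free_vars \<rho>')"
    by (auto simp: constant_on_def restricted_override \<rho>'(2))
  moreover have "vars t \<subseteq> free_vars \<rho>'"
    using t(4) by (auto simp: free_vars_def domIff subset_iff)
  then have "tree_function (free_vars \<rho>') \<beta> (restricted g \<rho>')"
    unfolding tree_function_def using t by (intro exI[of _ t]) (simp add: restricted_override T(4))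
  ultimately show ?thesis by blast
qed

end
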